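(* Let $(V,\delta_0,\{,\})$ be a dg (left) Leibniz algebra over a field $\mathbb{K}$ of characteristic zero, and let $\delta_t=\delta_0+t\delta_1+t^2\delta_2+\cdots$ be a formal deformation of $\delta_0$, i.e. a square-zero derivation of degree $+1$ on the Leibniz algebra $V[[t]]$ with coefficients $\delta_i\in\mathrm{Der}(V)$. For each $i\ge 1$ define the $i$-ary derived bracket $l_i:(sV)^{\otimes i}\to sV$ by $$l_i:=(-1)^{\frac{(i-1)(i-2)}{2}}\, s\circ N_i\circ (\underbrace{s^{-1}\otimes\cdots\otimes s^{-1}}_{i})\circ (s\delta_{i-1}s^{-1}\otimes \underbrace{1\otimes\cdots\otimes 1}_{i-1}),$$ where $N_i(x_1,\dots,x_i)=\{\dots\{\{x_1,x_2\},x_3\},\dots,x_i\}$ (and $N_1=1$). Then the system $(sV,l_1,l_2,l_3,\dots)$ is an sh Leibniz algebra.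
   Context: All vector spaces are graded, over a field $\mathbb{K}$ of characteristic zero; $|x|$ is the degree of $x$, and $(-1)^{x}$ means $(-1)^{|x|}$. The Koszul sign convention is used: $(f\otimes g)(x\otimes y)=(-1)^{|g||x|}f(x)\otimes g(y)$. The operator $s$ raises degree by $1$ and $s^{-1}$, its inverse, lowers degree by $1$; both are subject to the Koszul convention, e.g. $s\otimes s=(s\otimes 1)(1\otimes s)=-(1\otimes s)(s\otimes 1)$. $sV$ is the shifted space, $|sx|=|x|+1$. A dg (left) Leibniz algebra $(V,d,\{,\})$ is a graded vector space with a linear map $d$ of degree $+1$, $d^2=0$, and a bilinear bracket of degree $0$ such that $d\{x,y\}=\{dx,y\}+(-1)^{|x|}\{x,dy\}$ and $\{x,\{y,z\}\}=\{\{x,y\},z\}+(-1)^{|x||y|}\{y,\{x,z\}\}$. $\mathrm{Der}(V)$ is the space of derivations of the bracket: $D\{x,y\}=\{Dx,y\}+(-1)^{|D||x|}\{x,Dy\}$. $V[[t]]$ is the Leibniz algebra of formal power series in $t$ (a formal parameter of degree $0$) with coefficients in $V$, the bracket being extended $t$-linearly. A formal deformation $\delta_t=\sum_{i\ge0}t^i\delta_i$ of $\delta_0$ has each $\delta_i\in\mathrm{Der}(V)$ of degree $+1$, and $\delta_t^2=0$ is equivalent to $\sum_{i+j=m}\delta_i\delta_j=0$ for all $m\ge 0$. A graded vector space $W$ with multilinear maps $l_i:W^{\otimes i}\to W$ of degree $2-i$, $i\ge1$, is a strong homotopy (sh) Leibniz algebra if for every $n\ge1$ and all homogeneous $x_1,\dots,x_n\in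 W$, $$\sum_{\substack{i+j=n+1\\ i,j\ge1}}\ \sum_{k=j}^{i+j-1}\ \sum_{\sigma}\chi(\sigma)(-1)^{(k+1-j)(j-1)}(-1)^{j(x_{\sigma(1)}+\cdots+x_{\sigma(k-j)})}\, l_i\big(x_{\sigma(1)},\dots,x_{\sigma(k-j)},l_j(x_{\sigma(k+1-j)},\dots,x_{\sigma(k-1)},x_k),x_{k+1},\dots,x_{i+j-1}\big)=0,$$ where $\sigma\in S_{k-1}$ runs over $(k-j,j-1)$-unshuffles, i.e. $\sigma(1)<\cdots<\sigma(k-j)$ and $\sigma(k+1-j)<\cdots<\sigma(k-1)$, and $\chi(\sigma)=\mathrm{sgn}(\sigma)\epsilon(\sigma)$, with $\epsilon(\sigma)$ the Koszul sign of the permutation $(x_1,\dots,x_{k-1})\mapsto(x_{\sigma(1)},\dots,x_{\sigma(k-1)})$ of graded elements. *)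

theory Defs
  imports
    "HOL-Combinatorics.Permutations"
    "HOL-Computational_Algebra.Formal_Power_Series"
begin

section \<open>Graded vector spaces and graded maps\<close>

text \<open>A graded vector space is the direct sum of its homogeneous components \<open>V n\<close>, \<open>n \<in> \<int>\<close>.\<close>

locale graded_vector_space = vector_space scale
  for scale :: "'k::field_char_0 \<Rightarrow> 'v::ab_group_add \<Rightarrow> 'v" +
  fixes V :: "int \<Rightarrow> 'v set"
  assumes subspace_component: "subspace (V n)"
    and ex1_decomposition:
      "\<exists>!c. (\<forall>n. c n \<in> V n) \<and> finite {n. c n \<noteq> 0} \<and> x = (\<Sum>n | c n \<noteq> 0. c n)"

definition components :: "(int \<Rightarrow> 'v::ab_group_add set) \<Rightarrow> 'v \<Rightarrow> int \<Rightarrow> 'v" where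
  "components V x =
     (THE c. (\<forall>n. c n \<in> V n) \<and> finite {n. c n \<noteq> 0} \<and> x = (\<Sum>n | c n \<noteq> 0. c n))"

text \<open>The linear map with \<open>x \<mapsto> (-1)\<^bsup>k|x|\<^esup> x\<close> on homogeneous elements.\<close>

definition koszul_twist ::
  "('k::field_char_0 \<Rightarrow> 'v::ab_group_add \<Rightarrow> 'v) \<Rightarrow> (int \<Rightarrow> 'v set) \<Rightarrow> int \<Rightarrow> 'v \<Rightarrow> 'v" where
  "koszul_twist scale V k x =
     (\<Sum>n | components V x n \<noteq> 0. scale ((-1) powi (k * n)) (components V x n))"

text \<open>Multilinear maps \<open>W\<^bsup>\<otimes>i\<^esup> \<rightarrow> W\<close> are functions on lists of length \<open>i\<close>, and the list
  \<open>[x\<^sub>1, \<dots>, x\<^sub>i]\<close> stands for the elementary tensor \<open>x\<^sub>1 \<otimes> \<dots> \<otimes> x\<^sub>i\<close>.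
  A homogeneous map is paired with its degree, and \<open>f\<^sub>1 \<otimes> \<dots> \<otimes> f\<^sub>i\<close> is evaluated on elementary
  tensors by the Koszul rule \<open>(f \<otimes> g)(x \<otimes> y) = (-1)\<^bsup>|g||x|\<^esup> f(x) \<otimes> g(y)\<close>,
  where \<open>g\<close> is the tensor product of the remaining maps; the sign is absorbed in the factor
  \<open>f(x)\<close>. The grading \<open>V\<close> is the one on the common source of the maps.\<close>

fun tensor_map ::
  "('k::field_char_0 \<Rightarrow> 'v::ab_group_add \<Rightarrow> 'v) \<Rightarrow> (int \<Rightarrow> 'v set)
    \<Rightarrow> (('v \<Rightarrow> 'u) \<times> int) list \<Rightarrow> 'v list \<Rightarrow> 'u list" where
  "tensor_map scale V ((f, k) # fs) (x # xs) =
     f (koszul_twist scale V (sum_list (map snd fs)) x) # tensor_map scale V fs xs"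
| "tensor_map scale V _ _ = []"

definition multilinear ::
  "('k::field_char_0 \<Rightarrow> 'w::ab_group_add \<Rightarrow> 'w) \<Rightarrow> nat \<Rightarrow> ('w list \<Rightarrow> 'w) \<Rightarrow> bool" where
  "multilinear scale i l \<longleftrightarrow>
     (\<forall>xs a. length xs = i \<longrightarrow> a < i \<longrightarrow>
        Vector_Spaces.linear scale scale (\<lambda>x. l (xs[a := x])))"


section \<open>Differential graded Leibniz algebras\<close>

definition derivation ::
  "('k::field_char_0 \<Rightarrow> 'v::ab_group_add \<Rightarrow> 'v) \<Rightarrow> (int \<Rightarrow> 'v set) \<Rightarrow> ('v \<Rightarrow> 'v \<Rightarrow> 'v)
    \<Rightarrow> int \<Rightarrow> ('v \<Rightarrow> 'v) \<Rightarrow> bool" where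
  "derivation scale V br k D \<longleftrightarrow>
     Vector_Spaces.linear scale scale D \<and>
     (\<forall>n. \<forall>x\<in>V n. D x \<in> V (n + k)) \<and>
     (\<forall>n. \<forall>x\<in>V n. \<forall>y. D (br x y) = br (D x) y + scale ((-1) powi (k * n)) (br x (D y)))"

locale dg_leibniz_algebra = graded_vector_space scale V
  for scale :: "'k::field_char_0 \<Rightarrow> 'v::ab_group_add \<Rightarrow> 'v" and V :: "int \<Rightarrow> 'v set" +
  fixes d :: "'v \<Rightarrow> 'v" and br :: "'v \<Rightarrow> 'v \<Rightarrow> 'v"
  assumes linear_bracket_right: "Vector_Spaces.linear scale scale (\<lambda>y. br x y)"
    and linear_bracket_left: "Vector_Spaces.linear scale scale (\<lambda>x. br x y)"
    and degree_bracket: "x \<in> V m \<Longrightarrow> y \<in> V n \<Longrightarrow> br x y \<in> V (m + n)"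
    and leibniz: "x \<in> V m \<Longrightarrow> y \<in> V n \<Longrightarrow>
      br x (br y z) = br (br x y) z + scale ((-1) powi (m * n)) (br y (br x z))"
    and derivation_differential: "derivation scale V br 1 d"
    and differential_square: "d (d x) = 0"


section \<open>Formal deformations\<close>

text \<open>The space \<open>V[[t]]\<close> is the type of formal power series with coefficients in \<open>'v\<close>; as
  \<open>t\<close> has degree 0, a series is homogeneous of degree \<open>n\<close> iff all its coefficients are.\<close>

definition fps_scale :: "('k \<Rightarrow> 'v \<Rightarrow> 'v) \<Rightarrow> 'k \<Rightarrow> 'v fps \<Rightarrow> 'v::ab_group_add fps" where
  "fps_scale scale c f = Abs_fps (\<lambda>m. scale c (fps_nth f m))"

definition fps_grading :: "(int \<Rightarrow> 'v set) \<Rightarrow> int \<Rightarrow> 'v::ab_group_add fps set" where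
  "fps_grading V n = {f. \<forall>m. fps_nth f m \<in> V n}"

definition fps_bracket ::
  "('v \<Rightarrow> 'v \<Rightarrow> 'v) \<Rightarrow> 'v fps \<Rightarrow> 'v fps \<Rightarrow> 'v::ab_group_add fps" where
  "fps_bracket br f g = Abs_fps (\<lambda>m. \<Sum>i\<le>m. br (fps_nth f i) (fps_nth g (m - i)))"

text \<open>The \<open>t\<close>-linear operator \<open>\<delta>\<^sub>t = \<delta>\<^sub>0 + t \<delta>\<^sub>1 + t\<^sup>2 \<delta>\<^sub>2 + \<dots>\<close> on \<open>V[[t]]\<close>.\<close>

definition fps_operator :: "(nat \<Rightarrow> 'v \<Rightarrow> 'v) \<Rightarrow> 'v fps \<Rightarrow> 'v::ab_group_add fps" where
  "fps_operator \<delta> f = Abs_fps (\<lambda>m. \<Sum>i\<le>m. \<delta> i (fps_nth f (m - i)))"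

definition formal_deformation ::
  "('k::field_char_0 \<Rightarrow> 'v::ab_group_add \<Rightarrow> 'v) \<Rightarrow> (int \<Rightarrow> 'v set) \<Rightarrow> ('v \<Rightarrow> 'v \<Rightarrow> 'v)
    \<Rightarrow> ('v \<Rightarrow> 'v) \<Rightarrow> (nat \<Rightarrow> 'v \<Rightarrow> 'v) \<Rightarrow> bool" where
  "formal_deformation scale V br \<delta>\<^sub>0 \<delta> \<longleftrightarrow>
     \<delta> 0 = \<delta>\<^sub>0 \<and>
     (\<forall>i. derivation scale V br 1 (\<delta> i)) \<and>
     derivation (fps_scale scale) (fps_grading V) (fps_bracket br) 1 (fps_operator \<delta>) \<and>
     (\<forall>f. fps_operator \<delta> (fps_operator \<delta> f) = 0)"


section \<open>Suspension\<close>

text \<open>\<open>sV\<close> is a copy of \<open>V\<close> with the grading shifted; the constructor \<open>Susp\<close> is the operator \<open>s\<close>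
  of degree \<open>1\<close> and the selector \<open>desusp\<close> is \<open>s\<^sup>-\<^sup>1\<close>.\<close>

datatype 'v suspension = Susp (desusp: 'v)

instantiation suspension :: (ab_group_add) ab_group_add
begin

definition "0 = Susp 0"
definition "x + y = Susp (desusp x + desusp y)"
definition "x - y = Susp (desusp x - desusp y)"
definition "- x = Susp (- desusp x)"

instance
  by standard
    (simp_all add: zero_suspension_def plus_suspension_def minus_suspension_def
      uminus_suspension_def add.assoc add.commute)

end

definition susp_scale :: "('k \<Rightarrow> 'v \<Rightarrow> 'v) \<Rightarrow> 'k \<Rightarrow> 'v suspension \<Rightarrow> 'v suspension" where
  "susp_scale scale c x = Susp (scale c (desusp x))"

definition susp_grading :: "(int \<Rightarrow> 'v set) \<Rightarrow> int \<Rightarrow> 'v suspension set" where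
  "susp_grading V n = Susp ` V (n - 1)"


section \<open>Strong homotopy Leibniz algebras\<close>

text \<open>\<open>unshuffles p q\<close> is the set of \<open>(p, q)\<close>-unshuffles in \<open>S\<^bsub>p+q\<^esub>\<close>.\<close>

definition unshuffles :: "nat \<Rightarrow> nat \<Rightarrow> (nat \<Rightarrow> nat) set" where
  "unshuffles p q =
     {\<sigma>. \<sigma> permutes {1..p+q} \<and> strict_mono_on {1..p} \<sigma> \<and> strict_mono_on {p+1..p+q} \<sigma>}"

text \<open>The Koszul sign of \<open>(x\<^sub>1, \<dots>, x\<^sub>m) \<mapsto> (x\<^bsub>\<sigma>(1)\<^esub>, \<dots>, x\<^bsub>\<sigma>(m)\<^esub>)\<close>, where \<open>|x\<^sub>a| = e a\<close>: each pair
  of elements whose order is reversed contributes the product of their degrees to the exponent.\<close>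

definition koszul_sign :: "nat \<Rightarrow> (nat \<Rightarrow> nat) \<Rightarrow> (nat \<Rightarrow> int) \<Rightarrow> 'k::field_char_0" where
  "koszul_sign m \<sigma> e =
     (\<Prod>(a, b) \<in> {(a, b). 1 \<le> a \<and> a < b \<and> b \<le> m \<and> \<sigma> b < \<sigma> a}. (-1) powi (e (\<sigma> a) * e (\<sigma> b)))"

definition chi :: "nat \<Rightarrow> (nat \<Rightarrow> nat) \<Rightarrow> (nat \<Rightarrow> int) \<Rightarrow> 'k::field_char_0" where
  "chi m \<sigma> e = of_int (sign \<sigma>) * koszul_sign m \<sigma> e"

text \<open>\<open>l i\<close> is only constrained for \<open>i \<ge> 1\<close>, and only on lists of length \<open>i\<close>.\<close>

locale sh_leibniz_algebra = graded_vector_space scale W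
  for scale :: "'k::field_char_0 \<Rightarrow> 'w::ab_group_add \<Rightarrow> 'w" and W :: "int \<Rightarrow> 'w set" +
  fixes l :: "nat \<Rightarrow> 'w list \<Rightarrow> 'w"
  assumes multilinear_bracket: "1 \<le> i \<Longrightarrow> multilinear scale i (l i)"
    and degree_bracket: "1 \<le> i \<Longrightarrow> (\<And>a. a \<in> {1..i} \<Longrightarrow> x a \<in> W (e a)) \<Longrightarrow>
      l i (map x [1..<i+1]) \<in> W ((\<Sum>a = 1..i. e a) + (2 - int i))"
    and sh_leibniz_identity: "1 \<le> n \<Longrightarrow> (\<And>a. a \<in> {1..n} \<Longrightarrow> x a \<in> W (e a)) \<Longrightarrow>
      (\<Sum>(i, j) \<in> {(i, j). i + j = n + 1 \<and> 1 \<le> i \<and> 1 \<le> j}.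
        \<Sum>k = j..i+j-1. \<Sum>\<sigma> \<in> unshuffles (k - j) (j - 1).
          scale (chi (k - 1) \<sigma> e * (-1) ^ ((k + 1 - j) * (j - 1))
                  * (-1) powi (int j * (\<Sum>a = 1..k-j. e (\<sigma> a))))
            (l i (map (\<lambda>a. x (\<sigma> a)) [1..<k-j+1]
                  @ [l j (map (\<lambda>a. x (\<sigma> a)) [k+1-j..<k] @ [x k])]
                  @ map x [k+1..<i+j]))) = 0"


section \<open>Derived brackets\<close>

definition iterated_bracket :: "('v \<Rightarrow> 'v \<Rightarrow> 'v) \<Rightarrow> 'v list \<Rightarrow> 'v" where
  "iterated_bracket br xs = foldl br (hd xs) (tl xs)"

definition derived_bracket ::
  "('k::field_char_0 \<Rightarrow> 'v::ab_group_add \<Rightarrow> 'v) \<Rightarrow> (int \<Rightarrow> 'v set) \<Rightarrow> ('v \<Rightarrow> 'v \<Rightarrow> 'v)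
    \<Rightarrow> (nat \<Rightarrow> 'v \<Rightarrow> 'v) \<Rightarrow> nat \<Rightarrow> 'v suspension list \<Rightarrow> 'v suspension" where
  "derived_bracket scale V br \<delta> i xs =
     susp_scale scale ((-1) ^ ((i - 1) * (i - 2) div 2))
       (Susp (iterated_bracket br
         (tensor_map (susp_scale scale) (susp_grading V) (replicate i (desusp, -1))
           (tensor_map (susp_scale scale) (susp_grading V)
             ((Susp \<circ> \<delta> (i - 1) \<circ> desusp, 1) # replicate (i - 1) (id, 0)) xs))))"

end

theory Submission
  imports Defs
begin

text \<open>Write \<open>P D A = N(D v\<^bsub>a\<^sub>1\<^esub>, v\<^bsub>a\<^sub>2\<^esub>, \<dots>)\<close> for \<open>A = {a\<^sub>1 < a\<^sub>2 < \<dots>}\<close>. After desuspension all the signs of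
  the sh Leibniz identity collapse, up to a global one, to the Koszul sign of moving the odd
  derivation \<open>\<delta>\<^sub>q\<close> and the elements \<open>v\<^sub>b\<close>, \<open>b \<in> B\<close>, past the \<open>v\<^sub>a\<close>, \<open>a \<in> A\<close>; the summand becomes
  \<open>N(h(A, B \<union> {k}), v\<^bsub>k+1\<^esub>, \<dots>, v\<^sub>n)\<close> with \<open>h(A, B) = \<plusminus>{P \<delta>\<^sub>p A, P \<delta>\<^sub>q B}\<close> and
  \<open>A\<close>, \<open>B\<close> complementary in \<open>{1..k-1}\<close>. Two relations govern these terms, where \<open>h'\<close> is \<open>h\<close> with
  \<open>\<delta>\<^sub>p\<close> and \<open>\<delta>\<^sub>q\<close> interchanged: the Leibniz rule gives \<open>h(A, B \<union> {k}) + h'(B, A \<union> {k}) = {h(A, B), v\<^sub>k}\<close>,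
  and \<open>h(A, B) - h'(B, A)\<close> acts as zero from the left. By induction on \<open>n\<close> they imply that the
  \<open>(p, q)\<close> and the \<open>(q, p)\<close> part of the identity add up to
  \<open>N((\<delta>\<^sub>p\<delta>\<^sub>q + \<delta>\<^sub>q\<delta>\<^sub>p) v\<^sub>1, v\<^sub>2, \<dots>, v\<^sub>n)\<close>, and the sum of these over \<open>p + q = n - 1\<close> vanishes
  because \<open>\<delta>\<^sub>t\<close> squares to zero.\<close>

section \<open>Signs, derived words and their nested products\<close>

definition signed :: "int \<Rightarrow> 'v::ab_group_add \<Rightarrow> 'v" where
  "signed k x = (if even k then x else - x)"

lemma signed_signed [simp]: "signed k (signed l x) = signed (k + l) x"
  by (auto simp: signed_def)

lemma signed_0 [simp]: "signed 0 x = x"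
  by (simp add: signed_def)

lemma signed_cong: "even (k - l) \<Longrightarrow> signed k x = signed l x"
  by (auto simp: signed_def)

definition derived_word :: "('v \<Rightarrow> 'v \<Rightarrow> 'v) \<Rightarrow> ('v \<Rightarrow> 'v) \<Rightarrow> 'v::zero list \<Rightarrow> 'v" where
  "derived_word br D us = (case us of [] \<Rightarrow> 0 | u # us \<Rightarrow> foldl br (D u) us)"

definition derived_product :: "('v \<Rightarrow> 'v \<Rightarrow> 'v) \<Rightarrow> (nat \<Rightarrow> 'v::ab_group_add) \<Rightarrow> ('v \<Rightarrow> 'v) \<Rightarrow> nat set \<Rightarrow> 'v" where
  "derived_product br v D A = derived_word br D (map v (sorted_list_of_set A))"

text \<open>The exponent, in unsuspended degrees, of the Koszul sign that rearranges the increasing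
  sequence on \<open>A \<union> B\<close> into \<open>A\<close> followed by
  \<open>B\<close>.\<close>

definition inversion_degree :: "(nat \<Rightarrow> int) \<Rightarrow> nat set \<Rightarrow> nat set \<Rightarrow> int" where
  "inversion_degree f A B = (\<Sum>(a, b) \<in> {(a, b). a \<in> A \<and> b \<in> B \<and> b < a}. f a * f b)"

text \<open>The value at \<open>A = {}\<close> is \<open>D\<close> applied to the inner word: with no element before it, the inner
  word becomes the argument of \<open>D\<close>. The value at \<open>B = {}\<close> is chosen to make
  \<open>nested_product_swap\<close> and \<open>nested_product_insert_greatest\<close> hold without exception.\<close>

definition nested_product ::
  "('v \<Rightarrow> 'v \<Rightarrow> 'v) \<Rightarrow> (nat \<Rightarrow> 'v::ab_group_add) \<Rightarrow> (nat \<Rightarrow> int) \<Rightarrow> ('v \<Rightarrow> 'v) \<Rightarrow> ('v \<Rightarrow> 'v)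
    \<Rightarrow> nat set \<Rightarrow> nat set \<Rightarrow> 'v" where
  "nested_product br v f D D' A B =
     (if A = {} then D (derived_product br v D' B)
      else if B = {} then D' (derived_product br v D A)
      else signed (inversion_degree f A B + sum f A)
             (br (derived_product br v D A) (derived_product br v D' B)))"

lemma sorted_list_of_set_insert_greatest:
  assumes "finite A" "\<And>a. a \<in> A \<Longrightarrow> a < m"
  shows "sorted_list_of_set (insert m A) = sorted_list_of_set A @ [m::nat]"
proof (rule sorted_distinct_set_unique)
  show "sorted (sorted_list_of_set A @ [m])"
    using assms by (auto simp: sorted_append less_imp_le)
qed (use assms in \<open>auto simp del: sorted_list_of_set_insert_remove\<close>)

lemma derived_product_singleton [simp]: "derived_product br v D {a} = D (v a)"
  by (simp add: derived_product_def derived_word_def)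

lemma derived_product_insert_greatest:
  assumes "finite A" "A \<noteq> {}" "\<And>a. a \<in> A \<Longrightarrow> a < m"
  shows "derived_product br v D (insert m A) = br (derived_product br v D A) (v m)"
proof -
  have "sorted_list_of_set A \<noteq> []"
    using assms by simp
  then show ?thesis
    using sorted_list_of_set_insert_greatest[of A m] assms
    by (cases "sorted_list_of_set A") (auto simp: derived_product_def derived_word_def simp del: sorted_list_of_set_insert_remove)
qed

lemma inversion_degree_insert_greatest:
  assumes "\<And>a. a \<in> A \<Longrightarrow> a < m"
  shows "inversion_degree f A (insert m B) = inversion_degree f A B"
  unfolding inversion_degree_def by (rule sum.cong) (use assms in \<open>auto dest: order.asym\<close>)

text \<open>As \<open>A\<close> and \<open>B\<close> are disjoint, every pair in
  \<open>A \<times> B\<close> is inverted in exactly one of the two block orders.\<close>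

lemma inversion_degree_swap:
  assumes "finite A" "finite B" "A \<inter> B = {}"
  shows "inversion_degree f A B + inversion_degree f B A = sum f A * sum f B"
proof -
  have "inversion_degree f B A = (\<Sum>(a, b) \<in> {(a, b). a \<in> A \<and> b \<in> B \<and> a < b}. f a * f b)"
    unfolding inversion_degree_def
    by (rule sum.reindex_bij_witness[of _ prod.swap prod.swap]) (auto simp: mult.commute)
  then have "inversion_degree f A B + inversion_degree f B A =
      (\<Sum>(a, b) \<in> {(a, b). a \<in> A \<and> b \<in> B \<and> b < a} \<union> {(a, b). a \<in> A \<and> b \<in> B \<and> a < b}. f a * f b)"
    unfolding inversion_degree_def
    by (subst sum.union_disjoint)
       (use assms in \<open>auto intro: finite_subset[of _ "A \<times> B"]\<close>)
  also have "\<dots> = (\<Sum>(a, b) \<in> A \<times> B. f a * f b)"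
    by (rule sum.cong) (use assms in force)+
  finally show ?thesis
    by (simp add: sum_product sum.cartesian_product)
qed

lemma even_inversion_degree_swap:
  assumes "finite A" "finite B" "A \<inter> B = {}"
  shows "even (inversion_degree f A B) \<longleftrightarrow>
    (even (inversion_degree f B A) \<longleftrightarrow> even (sum f A) \<or> even (sum f B))"
  using arg_cong[OF inversion_degree_swap[OF assms, of f], of even] by (auto simp: even_add)

section \<open>The two relations between nested products\<close>

context dg_leibniz_algebra
begin

lemma scale_signed: "scale ((-1) powi k) x = signed k x"
  by (simp add: signed_def power_int_minus_left)

lemma br_add_left: "br (x + y) z = br x z + br y z"
  using linear_bracket_left[of z] unfolding linear_iff_module_hom by (rule module_hom.add)

lemma br_zero_left [simp]: "br 0 z = 0"
  using linear_bracket_left[of z] unfolding linear_iff_module_hom by (rule module_hom.zero)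

lemma br_minus_left: "br (- x) z = - br x z"
  using linear_bracket_left[of z] unfolding linear_iff_module_hom by (rule module_hom.neg)

lemma br_sum_left: "br (sum g X) z = (\<Sum>x\<in>X. br (g x) z)"
  using linear_bracket_left[of z] unfolding linear_iff_module_hom by (rule module_hom.sum)

lemma br_signed_left: "br (signed k x) z = signed k (br x z)"
  by (simp add: signed_def br_minus_left)

text \<open>The Leibniz identities for \<open>x, y\<close> and for \<open>y, x\<close> express the
  two sides by the same two double brackets, up to a common sign. Thus graded antisymmetry holds for
  the action from the left, although not for the bracket itself.\<close>

lemma br_antisymmetric:
  assumes "x \<in> V m" "y \<in> V n"
  shows "br (br x y) z = signed (m * n + 1) (br (br y x) z)"
proof -
  have "br (br x y) z = br x (br y z) - signed (m * n) (br y (br x z))"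
    using leibniz[OF assms, of z] by (simp add: scale_signed)
  moreover have "br (br y x) z = br y (br x z) - signed (n * m) (br x (br y z))"
    using leibniz[OF assms(2,1), of z] by (simp add: scale_signed)
  ultimately show ?thesis
    by (auto simp: signed_def mult.commute)
qed

lemma derived_product_degree:
  assumes "finite A" "A \<noteq> {}" "\<And>a. a \<in> A \<Longrightarrow> v a \<in> V (f a)"
    and "\<And>n x. x \<in> V n \<Longrightarrow> D x \<in> V (n + k)"
  shows "derived_product br v D A \<in> V (sum f A + k)"
  using assms(1-3)
proof (induction A rule: finite_linorder_max_induct)
  case (insert b A)
  show ?case
  proof (cases "A = {}")
    case True
    then show ?thesis using insert.prems assms(4) by simp
  next
    case False
    then have "br (derived_product br v D A) (v b) \<in> V ((sum f A + k) + f b)"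
      using insert by (intro degree_bracket) auto
    moreover have "b \<notin> A" using insert.hyps by auto
    ultimately show ?thesis
      using insert False by (simp add: derived_product_insert_greatest algebra_simps)
  qed
qed simp

context
  fixes v :: "nat \<Rightarrow> 'v" and f :: "nat \<Rightarrow> int" and D D' :: "'v \<Rightarrow> 'v" and m :: nat
  assumes v: "\<And>a. a \<in> {1..m} \<Longrightarrow> v a \<in> V (f a)"
    and D: "derivation scale V br 1 D" and D': "derivation scale V br 1 D'"
begin

text \<open>The derived words have degrees |A| + 1 and |B| + 1, so \<open>br_antisymmetric\<close>
  contributes (|A| + 1)(|B| + 1) + 1, congruent to |A||B| + |A| + |B| modulo 2. By
  \<open>inversion_degree_swap\<close> this is the discrepancy between the exponents of the two
  nested products.\<close>

lemma nested_product_swap: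
  assumes "A \<inter> B = {}" "A \<union> B = {1..m}" "m \<ge> 1"
  shows "br (nested_product br v f D D' A B) z = br (nested_product br v f D' D B A) z"
proof (cases "A = {} \<or> B = {}")
  case True
  then show ?thesis using assms by (auto simp: nested_product_def)
next
  case False
  have fin: "finite A" "finite B"
    using assms(2) by (metis finite_Un finite_atLeastAtMost)+
  have vf: "v a \<in> V (f a)" if "a \<in> A \<or> a \<in> B" for a
    using that v assms(2) by blast
  have "derived_product br v D A \<in> V (sum f A + 1)" "derived_product br v D' B \<in> V (sum f B + 1)"
    using D D' vf fin False by (auto intro!: derived_product_degree simp: derivation_def)
  from br_antisymmetric[OF this] show ?thesis
    using False even_inversion_degree_swap[OF fin assms(1), of f]
    by (simp add: nested_product_def br_signed_left)
      (rule signed_cong, auto)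
qed

text \<open>If both blocks are nonempty, this is the Leibniz identity for the two derived words and
  \<open>v (Suc m)\<close>; if one is empty, it is the derivation rule for the operator that acts on
  the whole inner word.\<close>

lemma nested_product_insert_greatest:
  assumes AB: "A \<inter> B = {}" "A \<union> B = {1..m}" "m \<ge> 1"
  shows "nested_product br v f D D' A (insert (Suc m) B) + nested_product br v f D' D B (insert (Suc m) A) =
    br (nested_product br v f D D' A B) (v (Suc m))"
proof -
  have fin: "finite A" "finite B"
    using assms(2) by (metis finite_Un finite_atLeastAtMost)+
  have lt: "a < Suc m" if "a \<in> A \<or> a \<in> B" for a
    using that assms(2) by (metis UnI1 UnI2 atLeastAtMost_iff le_imp_less_Suc)
  have vf: "v a \<in> V (f a)" if "a \<in> A \<or> a \<in> B" for a
    using that v assms(2) by blast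
  have deg: "derived_product br v E C \<in> V (sum f C + 1)"
    if "C = A \<or> C = B" "C \<noteq> {}" "derivation scale V br 1 E" for C E
    using vf fin that by (auto intro!: derived_product_degree simp: derivation_def)
  \<comment> \<open>The derived word has degree |C| + 1, so the second term of the derivation rule
    has the sign opposite to the exponent |C| of the nested product with inner block
    \<open>{Suc m}\<close>, and the two cancel.\<close>
  have one: "E (br (derived_product br v E' C) (v (Suc m)))
       + nested_product br v f E' E C {Suc m}
     = br (E (derived_product br v E' C)) (v (Suc m))"
    if "C = A \<or> C = B" "C \<noteq> {}" "derivation scale V br 1 E" "derivation scale V br 1 E'" for C E E'
  proof -
    have "inversion_degree f C {Suc m} = 0"
      using inversion_degree_insert_greatest[of C "Suc m" f "{}"] lt that(1)
      by (auto simp: inversion_degree_def)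
    then show ?thesis
      using that(3) deg[OF that(1,2,4)] that(2)
      by (auto simp: derivation_def nested_product_def scale_signed)
        (auto simp: signed_def split: if_splits)
  qed
  consider "A = {}" "B \<noteq> {}" | "B = {}" "A \<noteq> {}" | "A \<noteq> {}" "B \<noteq> {}"
    using assms by fastforce
  then show ?thesis
  proof cases
    case 1
    then show ?thesis
      using one[of B D D'] D D' lt fin
      by (simp add: nested_product_def derived_product_insert_greatest)
  next
    case 2
    then show ?thesis
      using one[of A D' D] D D' lt fin
      by (simp add: nested_product_def derived_product_insert_greatest add.commute)
  next
    case 3
    define x where "x = derived_product br v D A"
    define y where "y = derived_product br v D' B"
    have "x \<in> V (sum f A + 1)" "y \<in> V (sum f B + 1)"
      using deg D D' 3 by (simp_all add: x_def y_def)
    from leibniz[OF this, of "v (Suc m)"]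
    have L: "br (br x y) (v (Suc m)) = br x (br y (v (Suc m)))
        - signed ((sum f A + 1) * (sum f B + 1)) (br y (br x (v (Suc m))))"
      by (simp add: scale_signed)
    \<comment> \<open>The exponents differ by an odd number, so the second nested product is the
      term subtracted in \<open>L\<close>.\<close>
    have "signed (inversion_degree f B A + sum f B) z
        = - signed (inversion_degree f A B + sum f A + (sum f A + 1) * (sum f B + 1)) z" for z :: 'v
      using even_inversion_degree_swap[OF fin assms(1), of f]
      by (auto simp: signed_def)
    then show ?thesis
      using 3 fin lt L
      by (simp add: nested_product_def derived_product_insert_greatest
          inversion_degree_insert_greatest br_signed_left flip: x_def y_def)
        (simp add: signed_def)
  qed
qed

end

end

section \<open>Signs of unshuffles\<close>

text \<open>The product runs over all pairs, not only over the inversions: a fixed index set is what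
  makes multiplicativity accessible.\<close>

definition inversion_sign :: "nat \<Rightarrow> (nat \<Rightarrow> nat) \<Rightarrow> int" where
  "inversion_sign m \<sigma> = (\<Prod>(a, b) \<in> {(a, b). 1 \<le> a \<and> a < b \<and> b \<le> m}. if \<sigma> b < \<sigma> a then - 1 else 1)"

lemma finite_pairs: "finite {(a, b). 1 \<le> a \<and> a < b \<and> b \<le> (m::nat)}"
  by (rule finite_subset[of _ "{1..m} \<times> {1..m}"]) auto

text \<open>A pair is inverted by the composite iff exactly one of the two maps reverses the order
  at its stage. The factor of \<sigma> depends only on the unordered pair, so applying \<tau> to the
  pairs merely permutes these factors.\<close>

lemma inversion_sign_comp:
  assumes \<sigma>: "\<sigma> permutes {1..m}" and \<tau>: "\<tau> permutes {1..m}"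
  shows "inversion_sign m (\<sigma> \<circ> \<tau>) = inversion_sign m \<sigma> * inversion_sign m \<tau>"
proof -
  let ?P = "{(a, b). 1 \<le> a \<and> a < b \<and> b \<le> m}"
  define t :: "nat \<Rightarrow> nat \<Rightarrow> int" where "t a b = (if (\<sigma> a < \<sigma> b) = (a < b) then 1 else - 1)" for a b
  have neq: "\<sigma> a \<noteq> \<sigma> b" "\<tau> a \<noteq> \<tau> b" if "a \<noteq> b" for a b
    using that permutes_inj[OF \<sigma>] permutes_inj[OF \<tau>] by (simp_all add: inj_eq)
  have t_sym: "t a b = t b a" if "a \<noteq> b" for a b
    using neq(1)[OF that] that by (auto simp: t_def)
  \<comment> \<open>The action of a permutation on unordered pairs, each represented with its
    smaller element first.\<close>
  define g where "g \<rho> = (\<lambda>(a, b). (min (\<rho> a) (\<rho> b), max (\<rho> a) (\<rho> b)))" for \<rho> :: "nat \<Rightarrow> nat"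
  have g: "g \<rho> z \<in> ?P" if "z \<in> ?P" "\<rho> permutes {1..m}" for z \<rho>
  proof -
    obtain a b where z: "z = (a, b)" "1 \<le> a" "a < b" "b \<le> m"
      using \<open>z \<in> ?P\<close> by auto
    then have "\<rho> a \<in> {1..m}" "\<rho> b \<in> {1..m}" "\<rho> a \<noteq> \<rho> b"
      using permutes_in_image[OF that(2)] permutes_inj[OF that(2)] by (simp_all add: inj_eq)
    then show ?thesis
      by (auto simp: g_def z min_def max_def)
  qed
  have inv: "g (inv \<rho>) (g \<rho> z) = z" "g \<rho> (g (inv \<rho>) z) = z" if "z \<in> ?P" "\<rho> permutes {1..m}" for z \<rho>
    using that permutes_inverses[OF that(2)] by (auto simp: g_def min_def max_def)
  have "(\<Prod>(a, b)\<in>?P. t (\<tau> a) (\<tau> b)) = (\<Prod>(a, b)\<in>?P. t a b)"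
  proof (rule prod.reindex_bij_witness[of _ "g (inv \<tau>)" "g \<tau>"])
    fix z assume z: "z \<in> ?P"
    then obtain a b where "z = (a, b)" "a < b" by auto
    then show "(case g \<tau> z of (a, b) \<Rightarrow> t a b) = (case z of (a, b) \<Rightarrow> t (\<tau> a) (\<tau> b))"
      using neq(2)[of a b] t_sym[of "\<tau> a" "\<tau> b"] by (simp add: g_def min_def max_def)
    show "g (inv \<tau>) (g \<tau> z) = z" "g \<tau> (g (inv \<tau>) z) = z"
      using inv[OF z \<tau>] by simp_all
    show "g \<tau> z \<in> ?P" "g (inv \<tau>) z \<in> ?P"
      using g[OF z] \<tau> permutes_inv[OF \<tau>] by simp_all
  qed
  moreover have "(\<Prod>(a, b)\<in>?P. t a b) = inversion_sign m \<sigma>"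
    unfolding inversion_sign_def
  proof (intro prod.cong refl, clarify)
    fix a b :: nat assume "a < b"
    then show "t a b = (if \<sigma> b < \<sigma> a then - 1 else 1)"
      using neq(1)[of a b] by (auto simp: t_def)
  qed
  moreover have "inversion_sign m (\<sigma> \<circ> \<tau>) = (\<Prod>(a, b)\<in>?P. t (\<tau> a) (\<tau> b)) * inversion_sign m \<tau>"
    unfolding inversion_sign_def prod.distrib[symmetric]
  proof (intro prod.cong refl, clarify)
    fix a b :: nat assume "a < b"
    then have "\<tau> a \<noteq> \<tau> b" "\<sigma> (\<tau> a) \<noteq> \<sigma> (\<tau> b)"
      using neq(2)[of a b] neq(1)[of "\<tau> a" "\<tau> b"] by simp_all
    then show "(if (\<sigma> \<circ> \<tau>) b < (\<sigma> \<circ> \<tau>) a then - 1 else 1) =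
        t (\<tau> a) (\<tau> b) * (if \<tau> b < \<tau> a then - 1 else 1)"
      by (auto simp: t_def)
  qed
  ultimately show ?thesis by simp
qed

lemma inversion_sign_eq_power:
  "inversion_sign m \<sigma> = (- 1) ^ card {(a, b). 1 \<le> a \<and> a < b \<and> b \<le> m \<and> \<sigma> b < \<sigma> a}"
proof -
  have "inversion_sign m \<sigma> = (\<Prod>(a, b) \<in> {(a, b). 1 \<le> a \<and> a < b \<and> b \<le> m \<and> \<sigma> b < \<sigma> a}. - 1)"
    unfolding inversion_sign_def by (rule prod.mono_neutral_cong_right[OF finite_pairs]) (auto split: if_splits)
  then show ?thesis by (simp add: split_def)
qed

text \<open>The inverted pairs are \<open>(a, b)\<close> itself and, for each \<open>c\<close>
  strictly between, \<open>(a, c)\<close> and \<open>(c, b)\<close>: an odd number.\<close>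

lemma inversion_sign_transpose:
  assumes "1 \<le> a" "a < b" "b \<le> m"
  shows "inversion_sign m (Transposition.transpose a b) = - 1"
proof -
  let ?C = "{a<..<b}"
  have "{(c, d). 1 \<le> c \<and> c < d \<and> d \<le> m \<and> Transposition.transpose a b d < Transposition.transpose a b c} =
      insert (a, b) (Pair a ` ?C \<union> (\<lambda>c. (c, b)) ` ?C)"
    using assms by (auto simp: Transposition.transpose_def split: if_splits)
  moreover have "card (Pair a ` ?C \<union> (\<lambda>c. (c, b)) ` ?C) = card ?C + card ?C"
    by (subst card_Un_disjoint) (auto simp: card_image inj_on_def)
  then have "card (insert (a, b) (Pair a ` ?C \<union> (\<lambda>c. (c, b)) ` ?C)) = Suc (card ?C + card ?C)"
    by (subst card_insert_disjoint) auto
  ultimately show ?thesis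
    by (simp add: inversion_sign_eq_power)
qed

text \<open>Both sides are multiplicative, equal 1 at the identity and -1 at transpositions.\<close>

lemma sign_eq_power_inversions:
  fixes m :: nat
  assumes "\<sigma> permutes {1..m}"
  shows "sign \<sigma> = (- 1) ^ card {(a, b). 1 \<le> a \<and> a < b \<and> b \<le> m \<and> \<sigma> b < \<sigma> a}"
proof -
  have "inversion_sign m \<sigma> = sign \<sigma>"
    using assms finite_atLeastAtMost
  proof (induction rule: permutes_induct)
    case id
    show ?case by (simp add: inversion_sign_def prod.neutral)
  next
    case (swap a b \<sigma>)
    show ?case
    proof (cases "a = b")
      case True
      then show ?thesis using swap by simp
    next
      case False
      have "inversion_sign m (Transposition.transpose a b) = - 1"
        using inversion_sign_transpose[of a b m] inversion_sign_transpose[of b a m] swap False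
        by (cases a b rule: linorder_cases) (auto simp: transpose_commute)
      then show ?thesis
        using swap False
        by (subst inversion_sign_comp)
          (auto simp: sign_compose permutation_swap_id sign_swap_id permutes_swap_id
            dest: permutes_imp_permutation[rotated])
    qed
  qed
  then show ?thesis by (simp add: inversion_sign_eq_power)
qed

lemma prod_minus_one_powi:
  "(\<Prod>x\<in>X. (-1) powi g x) = ((-1) powi (\<Sum>x\<in>X. g x) :: 'a::field)"
  by (induction X rule: infinite_finite_induct) (simp_all add: power_int_add)

section \<open>Unshuffles as subsets, and their signs\<close>

lemma sorted_list_of_set_image_strict_mono:
  fixes \<sigma> :: "nat \<Rightarrow> nat"
  assumes "strict_mono_on {i..<j} \<sigma>"
  shows "sorted_list_of_set (\<sigma> ` {i..<j}) = map \<sigma> [i..<j]"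
proof (rule sorted_distinct_set_unique)
  have "sorted_wrt (<) (map \<sigma> [i..<j])"
    unfolding sorted_wrt_iff_nth_less
    by (auto intro: strict_mono_onD[OF assms])
  then show "sorted (map \<sigma> [i..<j])" "distinct (map \<sigma> [i..<j])"
    by (simp_all add: strict_sorted_iff)
qed simp_all

lemma unshuffle_blocks:
  assumes "\<sigma> \<in> unshuffles p q"
  shows "\<sigma> ` {1..p} = {1..p+q} - \<sigma> ` {p+1..p+q}" "\<sigma> ` {p+1..p+q} \<subseteq> {1..p+q}"
    and "card (\<sigma> ` {1..p}) = p" "card (\<sigma> ` {p+1..p+q}) = q"
    and "map \<sigma> [1..<p+1] = sorted_list_of_set (\<sigma> ` {1..p})"
    and "map \<sigma> [p+1..<p+q+1] = sorted_list_of_set (\<sigma> ` {p+1..p+q})"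
proof -
  have \<sigma>: "\<sigma> permutes {1..p+q}" and mono: "strict_mono_on {1..p} \<sigma>" "strict_mono_on {p+1..p+q} \<sigma>"
    using assms by (auto simp: unshuffles_def)
  have inj: "inj_on \<sigma> X" for X
    using permutes_inj[OF \<sigma>] by (rule inj_on_subset) simp
  have disj: "\<sigma> ` {1..p} \<inter> \<sigma> ` {p+1..p+q} = {}"
    by (subst inj_on_image_Int[OF inj[of UNIV], symmetric]) auto
  have "{1..p} \<union> {p+1..p+q} = {1..p+q}"
    by auto
  then have "{1..p+q} = \<sigma> ` {1..p} \<union> \<sigma> ` {p+1..p+q}"
    using permutes_image[OF \<sigma>] by (simp flip: image_Un)
  then show "\<sigma> ` {1..p} = {1..p+q} - \<sigma> ` {p+1..p+q}" "\<sigma> ` {p+1..p+q} \<subseteq> {1..p+q}"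
    using disj by blast+
  show "card (\<sigma> ` {1..p}) = p" "card (\<sigma> ` {p+1..p+q}) = q"
    by (simp_all add: card_image[OF inj])
  have ivl: "{a..<b+1} = {a..b}" for a b :: nat
    by auto
  show "map \<sigma> [1..<p+1] = sorted_list_of_set (\<sigma> ` {1..p})"
    "map \<sigma> [p+1..<p+q+1] = sorted_list_of_set (\<sigma> ` {p+1..p+q})"
    using sorted_list_of_set_image_strict_mono[of 1 "p + 1" \<sigma>]
      sorted_list_of_set_image_strict_mono[of "p + 1" "p + q + 1" \<sigma>] mono
    unfolding ivl by simp_all
qed

text \<open>Being increasing on both blocks, an unshuffle is recovered from its second block. This
  turns sums over unshuffles into sums over the sets of inner entries.\<close>

lemma bij_betw_unshuffles:
  "bij_betw (\<lambda>\<sigma>. \<sigma> ` {p+1..p+q}) (unshuffles p q) {B. B \<subseteq> {1..p+q} \<and> card B = q}"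
proof (rule bij_betwI')
  fix \<sigma> \<tau> assume \<sigma>: "\<sigma> \<in> unshuffles p q" and \<tau>: "\<tau> \<in> unshuffles p q"
  show "\<sigma> ` {p+1..p+q} = \<tau> ` {p+1..p+q} \<longleftrightarrow> \<sigma> = \<tau>"
  proof
    assume eq: "\<sigma> ` {p+1..p+q} = \<tau> ` {p+1..p+q}"
    then have "\<sigma> ` {1..p} = \<tau> ` {1..p}"
      using unshuffle_blocks(1)[OF \<sigma>] unshuffle_blocks(1)[OF \<tau>] by simp
    with eq have lists: "map \<sigma> [1..<p+1] = map \<tau> [1..<p+1]" "map \<sigma> [p+1..<p+q+1] = map \<tau> [p+1..<p+q+1]"
      using unshuffle_blocks(5,6)[OF \<sigma>] unshuffle_blocks(5,6)[OF \<tau>] by simp_all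
    show "\<sigma> = \<tau>"
    proof
      fix a
      consider "a \<in> set [1..<p+1]" | "a \<in> set [p+1..<p+q+1]" | "a \<notin> {1..p+q}"
        by fastforce
      then show "\<sigma> a = \<tau> a"
      proof cases
        case 3
        then show ?thesis
          using \<sigma> \<tau> by (simp add: unshuffles_def permutes_def)
      qed (use lists in \<open>simp_all only: map_eq_conv\<close>)
    qed
  qed simp
next
  fix \<sigma> assume "\<sigma> \<in> unshuffles p q"
  then show "\<sigma> ` {p+1..p+q} \<in> {B. B \<subseteq> {1..p+q} \<and> card B = q}"
    using unshuffle_blocks(2,4)[of \<sigma> p q] by simp
next
  fix B assume "B \<in> {B. B \<subseteq> {1..p+q} \<and> card B = q}"
  then have B: "B \<subseteq> {1..p+q}" "card B = q" "finite B"
    using finite_subset by auto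
  define A where "A = {1..p+q} - B"
  have A: "finite A" "card A = p"
    using B by (auto simp: A_def card_Diff_subset)
  \<comment> \<open>The preimage of \<open>B\<close> enumerates the complement of \<open>B\<close>
    and then \<open>B\<close>, each increasingly.\<close>
  define L where "L = sorted_list_of_set A @ sorted_list_of_set B"
  have L: "length L = p + q" "distinct L" "set L = {1..p+q}"
    using A B by (auto simp: L_def A_def)
  \<comment> \<open>Positions start at 1 and list indices at 0; outside the range
    \<open>permutes\<close> demands the identity.\<close>
  define \<sigma> where "\<sigma> a = (if a \<in> {1..p+q} then L ! (a - 1) else a)" for a
  have left: "\<sigma> a = sorted_list_of_set A ! (a - 1)" if "a \<in> {1..p}" for a
    using that A by (auto simp: \<sigma>_def L_def nth_append)
  have right: "\<sigma> a = sorted_list_of_set B ! (a - 1 - p)" if "a \<in> {p+1..p+q}" for a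
    using that A by (auto simp: \<sigma>_def L_def nth_append)
  have "bij_betw ((!) L \<circ> (\<lambda>a. a - 1)) {1..p+q} {1..p+q}"
  proof (rule bij_betw_trans)
    show "bij_betw (\<lambda>a. a - 1) {1..p+q} {..<p+q}"
      by (rule bij_betw_byWitness[of _ Suc]) auto
    show "bij_betw ((!) L) {..<p+q} {1..p+q}"
      using L by (intro bij_betw_nth) auto
  qed
  then have "bij_betw \<sigma> {1..p+q} {1..p+q}"
    by (subst bij_betw_cong[of _ _ "(!) L \<circ> (\<lambda>a. a - 1)"]) (simp_all add: \<sigma>_def)
  then have "\<sigma> permutes {1..p+q}"
    by (rule bij_imp_permutes) (simp only: \<sigma>_def if_False)
  moreover have nth_less: "sorted_list_of_set X ! i < sorted_list_of_set X ! j"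
    if "i < j" "j < card X" for X :: "nat set" and i j
    using sorted_wrt_nth_less[OF strict_sorted_list_of_set[of X] that(1)] that(2) by simp
  have "strict_mono_on {1..p} \<sigma>" "strict_mono_on {p+1..p+q} \<sigma>"
    using nth_less[of _ _ A] nth_less[of _ _ B] A B
    by (auto simp: strict_mono_on_def left right)
  ultimately have "\<sigma> \<in> unshuffles p q"
    by (simp add: unshuffles_def)
  moreover have "\<sigma> ` {p+1..p+q} = B"
  proof -
    have "\<sigma> ` {p+1..p+q} = (\<lambda>i. sorted_list_of_set B ! i) ` (\<lambda>a. a - 1 - p) ` {p+1..p+q}"
      unfolding image_image by (rule image_cong) (use right in auto)
    also have "(\<lambda>a. a - 1 - p) ` {p+1..p+q} = {0..<q}"
    proof (intro equalityI subsetI)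
      fix i assume "i \<in> {0..<q}"
      then show "i \<in> (\<lambda>a. a - 1 - p) ` {p+1..p+q}"
        by (intro image_eqI[of _ _ "i + p + 1"]) auto
    qed auto
    also have "(\<lambda>i. sorted_list_of_set B ! i) ` {0..<q} = B"
      using nth_image[of q "sorted_list_of_set B"] B by simp
    finally show ?thesis .
  qed
  ultimately show "\<exists>\<sigma>\<in>unshuffles p q. B = \<sigma> ` {p+1..p+q}"
    by blast
qed

text \<open>Every inversion of an unshuffle pairs some \<open>a\<close> in \<open>A\<close> with a
  smaller \<open>b\<close> in \<open>B\<close>. It contributes 1 through the signature and
  \<open>e a * e b\<close> through the Koszul sign, and 1 + (f a + 1)(f b + 1) is congruent to f a f
  b + f a + f b modulo 2.\<close>

lemma chi_unshuffle:
  assumes \<sigma>: "\<sigma> \<in> unshuffles p q" and e: "\<And>a. e a = f a + 1"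
  defines "A \<equiv> \<sigma> ` {1..p}" and "B \<equiv> \<sigma> ` {p+1..p+q}"
  shows "chi (p + q) \<sigma> e = ((-1) powi (inversion_degree f A B
      + (\<Sum>a\<in>A. int (card {b \<in> B. b < a}) * f a) + (\<Sum>b\<in>B. int (card {a \<in> A. b < a}) * f b))
      :: 'a::field_char_0)"
proof -
  have perm: "\<sigma> permutes {1..p+q}" and mono: "strict_mono_on {1..p} \<sigma>" "strict_mono_on {p+1..p+q} \<sigma>"
    using \<sigma> by (auto simp: unshuffles_def)
  define I where "I = {(a, b). 1 \<le> a \<and> a < b \<and> b \<le> p + q \<and> \<sigma> b < \<sigma> a}"
  \<comment> \<open>The inversions by their values, where \<open>I\<close> lists them by
    positions.\<close>
  define J where "J = (SIGMA a:A. {b \<in> B. b < a})"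
  have fin: "finite A" "finite B"
    by (simp_all add: A_def B_def)
  have "bij_betw (map_prod \<sigma> \<sigma>) I J"
  proof (rule bij_betwI')
    fix x y show "map_prod \<sigma> \<sigma> x = map_prod \<sigma> \<sigma> y \<longleftrightarrow> x = y"
      using permutes_inj[OF perm] by (cases x; cases y) (simp add: inj_eq)
  next
    fix x assume "x \<in> I"
    then obtain a b where x: "x = (a, b)" "1 \<le> a" "a < b" "b \<le> p + q" "\<sigma> b < \<sigma> a"
      by (auto simp: I_def)
    have "\<not> b \<le> p" "\<not> a \<ge> p + 1"
      using strict_mono_onD[OF mono(1), of a b] strict_mono_onD[OF mono(2), of a b] x by auto
    then show "map_prod \<sigma> \<sigma> x \<in> J"
      using x by (auto simp: J_def A_def B_def)
  next
    fix y assume "y \<in> J"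
    then obtain a b where "y = (\<sigma> a, \<sigma> b)" "a \<in> {1..p}" "b \<in> {p+1..p+q}" "\<sigma> b < \<sigma> a"
      by (auto simp: J_def A_def B_def)
    then show "\<exists>x\<in>I. y = map_prod \<sigma> \<sigma> x"
      by (intro bexI[of _ "(a, b)"]) (auto simp: I_def)
  qed
  then have reindex: "(\<Sum>x\<in>I. g (map_prod \<sigma> \<sigma> x)) = sum g J" for g :: "nat \<times> nat \<Rightarrow> int"
    by (rule sum.reindex_bij_betw)
  have "chi (p + q) \<sigma> e = ((-1) powi (int (card I)) * (-1) powi (\<Sum>(a, b)\<in>I. e (\<sigma> a) * e (\<sigma> b)) :: 'a)"
    unfolding chi_def koszul_sign_def sign_eq_power_inversions[OF perm] I_def[symmetric]
    by (simp add: split_def prod_minus_one_powi)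
  also have "\<dots> = (-1) powi (\<Sum>(a, b)\<in>I. 1 + e (\<sigma> a) * e (\<sigma> b))"
    by (simp add: power_int_add sum.distrib split_def)
  also have "(\<Sum>(a, b)\<in>I. 1 + e (\<sigma> a) * e (\<sigma> b)) = (\<Sum>(a, b)\<in>J. 1 + e a * e b)"
    using reindex[of "\<lambda>(a, b). 1 + e a * e b"] by (simp add: split_def)
  also have "\<dots> = (\<Sum>(a, b)\<in>J. f a * f b) + (\<Sum>(a, b)\<in>J. f a) + (\<Sum>(a, b)\<in>J. f b) + 2 * int (card J)"
    by (simp add: e algebra_simps sum.distrib split_def)
  also have "(\<Sum>(a, b)\<in>J. f a * f b) = inversion_degree f A B"
    unfolding inversion_degree_def by (rule sum.cong) (auto simp: J_def)
  also have "(\<Sum>(a, b)\<in>J. f a) = (\<Sum>a\<in>A. int (card {b \<in> B. b < a}) * f a)"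
    unfolding J_def by (subst sum.Sigma[symmetric]) (use fin in auto)
  also have "(\<Sum>(a, b)\<in>J. f b) = (\<Sum>(b, a)\<in>(SIGMA b:B. {a \<in> A. b < a}). f b)"
    by (rule sum.reindex_bij_witness[of _ prod.swap prod.swap]) (auto simp: J_def)
  also have "\<dots> = (\<Sum>b\<in>B. int (card {a \<in> A. b < a}) * f b)"
    by (subst sum.Sigma[symmetric]) (use fin in auto)
  finally show ?thesis
    by (simp add: power_int_minus_left)
qed

section \<open>Derived brackets of homogeneous elements\<close>

context graded_vector_space
begin

text \<open>The set \<open>S\<close> may exceed the support, so that two elements can be decomposed
  over one common index set.\<close>

lemma components_unique:
  assumes "\<And>n. c n \<in> V n" "finite S" "{n. c n \<noteq> 0} \<subseteq> S" "x = (\<Sum>n\<in>S. c n)"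
  shows "components V x = c"
proof -
  have "finite {n. c n \<noteq> 0}" "x = (\<Sum>n | c n \<noteq> 0. c n)"
    using assms finite_subset by (auto intro!: sum.mono_neutral_right)
  then show ?thesis
    unfolding components_def
    by (intro the1_equality ex1_decomposition conjI allI assms(1))
qed

lemma components_in: "components V x n \<in> V n"
  and finite_components: "finite {n. components V x n \<noteq> 0}"
  and sum_components: "(\<Sum>n | components V x n \<noteq> 0. components V x n) = x"
  using theI'[OF ex1_decomposition[of x]] unfolding components_def[symmetric] by auto

lemma zero_in_component: "0 \<in> V n"
  using subspace_0[OF subspace_component] .

lemma components_homogeneous:
  assumes "x \<in> V n"
  shows "components V x = (\<lambda>m. if m = n then x else 0)"
  by (rule components_unique[of _ "{n}"]) (use assms zero_in_component in auto)

lemma koszul_twist_eq: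
  assumes "finite S" "{n. components V x n \<noteq> 0} \<subseteq> S"
  shows "koszul_twist scale V k x = (\<Sum>n\<in>S. signed (k * n) (components V x n))"
proof -
  have "koszul_twist scale V k x = (\<Sum>n | components V x n \<noteq> 0. signed (k * n) (components V x n))"
    unfolding koszul_twist_def by (rule sum.cong) (simp_all add: signed_def power_int_minus_left)
  also have "\<dots> = (\<Sum>n\<in>S. signed (k * n) (components V x n))"
    by (rule sum.mono_neutral_left) (use assms in \<open>auto simp: signed_def\<close>)
  finally show ?thesis .
qed

lemma koszul_twist_homogeneous:
  assumes "x \<in> V n"
  shows "koszul_twist scale V k x = signed (k * n) x"
proof -
  have "{m. components V x m \<noteq> 0} \<subseteq> {n}"
    by (auto simp: components_homogeneous[OF assms] split: if_splits)
  then show ?thesis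
    using koszul_twist_eq[of "{n}" x k] by (simp add: components_homogeneous[OF assms])
qed

text \<open>By uniqueness of the decomposition, components are linear in the element. The brackets
  must be multilinear on all arguments, including inhomogeneous ones, for which the twist is not a
  single sign.\<close>

lemma linear_koszul_twist: "Vector_Spaces.linear scale scale (koszul_twist scale V k)"
proof -
  have add: "koszul_twist scale V k (x + y) = koszul_twist scale V k x + koszul_twist scale V k y" for x y
  proof -
    let ?S = "{n. components V x n \<noteq> 0} \<union> {n. components V y n \<noteq> 0}"
    have S: "finite ?S"
      by (simp add: finite_components)
    have sum: "(\<Sum>n\<in>?S. components V z n) = z" if "{n. components V z n \<noteq> 0} \<subseteq> ?S" for z
      using sum.mono_neutral_left[OF S that, of "components V z"] sum_components[of z] by auto
    have "components V (x + y) = (\<lambda>n. components V x n + components V y n)"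
      by (rule components_unique[OF _ S])
        (auto simp: sum.distrib sum intro: subspace_add[OF subspace_component] components_in)
    moreover from this have "{n. components V (x + y) n \<noteq> 0} \<subseteq> ?S"
      by auto
    ultimately show ?thesis
      using koszul_twist_eq[OF S, of x k] koszul_twist_eq[OF S, of y k] koszul_twist_eq[OF S, of "x + y" k]
      by (simp add: sum.distrib[symmetric]) (auto intro!: sum.cong simp: signed_def)
  qed
  have scale: "koszul_twist scale V k (scale c x) = scale c (koszul_twist scale V k x)" for c x
  proof -
    let ?S = "{n. components V x n \<noteq> 0}"
    have "components V (scale c x) = (\<lambda>n. scale c (components V x n))"
      by (rule components_unique[OF _ finite_components[of x]])
        (auto simp: scale_sum_right[symmetric] sum_components intro: subspace_scale[OF subspace_component] components_in)
    moreover from this have "{n. components V (scale c x) n \<noteq> 0} \<subseteq> ?S"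
      by auto
    ultimately show ?thesis
      using koszul_twist_eq[OF finite_components[of x], of x k] koszul_twist_eq[OF finite_components[of x], of "scale c x" k]
      by (simp add: scale_sum_right) (auto intro!: sum.cong simp: signed_def)
  qed
  show ?thesis
    by (simp add: Vector_Spaces.linear_iff add scale vector_space_axioms)
qed

section \<open>The grading of the suspension\<close>

lemma vector_space_susp: "vector_space (susp_scale scale)"
  by standard
    (simp_all add: susp_scale_def plus_suspension_def scale_right_distrib scale_left_distrib)

lemma sum_susp: "(\<Sum>n\<in>S. Susp (g n)) = Susp (\<Sum>n\<in>S. g n)"
  by (induction S rule: infinite_finite_induct) (simp_all add: zero_suspension_def plus_suspension_def)

lemma desusp_sum: "desusp (\<Sum>n\<in>S. g n) = (\<Sum>n\<in>S. desusp (g n))"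
  by (induction S rule: infinite_finite_induct) (simp_all add: zero_suspension_def plus_suspension_def)

lemma Susp_mem_susp_grading [simp]: "Susp u \<in> susp_grading V n \<longleftrightarrow> u \<in> V (n - 1)"
  by (auto simp: susp_grading_def)

text \<open>The component of \<open>Susp u\<close> in degree n is the suspension of the component of
  \<open>u\<close> in degree n - 1; existence and uniqueness are transported along this
  shift.\<close>

lemma graded_vector_space_susp: "graded_vector_space (susp_scale scale) (susp_grading V)"
proof (intro graded_vector_space.intro graded_vector_space_axioms.intro vector_space_susp)
  interpret susp: vector_space "susp_scale scale"
    by (rule vector_space_susp)
  fix n
  have "0 \<in> V (n - 1)" "\<And>c u. u \<in> V (n - 1) \<Longrightarrow> scale c u \<in> V (n - 1)"
    "\<And>u w. u \<in> V (n - 1) \<Longrightarrow> w \<in> V (n - 1) \<Longrightarrow> u + w \<in> V (n - 1)"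
    using subspace_component[of "n - 1"] by (simp_all add: subspace_def)
  then show "susp.subspace (susp_grading V n)"
    unfolding susp.subspace_def
    by (auto simp: susp_grading_def susp_scale_def zero_suspension_def plus_suspension_def)
next
  fix x :: "'v suspension"
  obtain u where x: "x = Susp u" by (cases x)
  let ?P = "\<lambda>c. (\<forall>n. c n \<in> susp_grading V n) \<and> finite {n. c n \<noteq> 0} \<and> x = (\<Sum>n | c n \<noteq> 0. c n)"
  have shift: "{n. f (n - 1) \<noteq> 0} = (\<lambda>n. n + 1) ` {n. f n \<noteq> 0}" for f :: "int \<Rightarrow> 'v"
    by (auto simp: image_iff intro!: exI[of _ "_ - 1"])
  show "\<exists>!c. ?P c"
  proof (rule ex1I[of _ "\<lambda>n. Susp (components V u (n - 1))"])
    have supp: "{n. Susp (components V u (n - 1)) \<noteq> 0} = (\<lambda>n. n + 1) ` {n. components V u n \<noteq> 0}"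
      unfolding shift[symmetric] by (simp add: zero_suspension_def)
    then show "?P (\<lambda>n. Susp (components V u (n - 1)))"
      using finite_components[of u] components_in[of u]
      by (simp add: sum_susp x sum.reindex sum_components)
  next
    fix c assume c: "?P c"
    have "components V u = (\<lambda>n. desusp (c (n + 1)))"
    proof (rule components_unique[of _ "(\<lambda>n. n - 1) ` {n. c n \<noteq> 0}"])
      show "desusp (c (n + 1)) \<in> V n" for n
        using c[THEN conjunct1, rule_format, of "n + 1"] by (auto simp: susp_grading_def)
      show "finite ((\<lambda>n. n - 1) ` {n. c n \<noteq> 0})"
        using c by simp
      show "{n. desusp (c (n + 1)) \<noteq> 0} \<subseteq> (\<lambda>n. n - 1) ` {n. c n \<noteq> 0}"
      proof
        fix n assume "n \<in> {n. desusp (c (n + 1)) \<noteq> 0}"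
        then show "n \<in> (\<lambda>n. n - 1) ` {n. c n \<noteq> 0}"
          by (intro image_eqI[of _ _ "n + 1"]) (auto simp: zero_suspension_def)
      qed
      have "u = desusp (\<Sum>n | c n \<noteq> 0. c n)"
        using c by (metis x suspension.sel)
      then show "u = (\<Sum>n\<in>(\<lambda>n. n - 1) ` {n. c n \<noteq> 0}. desusp (c (n + 1)))"
        by (simp add: sum.reindex inj_on_def desusp_sum)
    qed
    then show "c = (\<lambda>n. Susp (components V u (n - 1)))"
      by simp
  qed
qed

end

section \<open>Signs produced by desuspension\<close>

lemma signed_Susp: "signed k (Susp u) = Susp (signed k u)"
  by (simp add: signed_def uminus_suspension_def)

text \<open>Each degree is weighted by the number of later entries, that is, by the number of
  desuspensions that move past the entry.\<close>

primrec position_weight :: "int list \<Rightarrow> int" where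
  "position_weight [] = 0"
| "position_weight (g # gs) = int (length gs) * g + position_weight gs"

lemma position_weight_append:
  "position_weight (gs @ hs) =
    position_weight gs + int (length hs) * sum_list gs + position_weight hs"
  by (induction gs) (simp_all add: algebra_simps)

lemma position_weight_sorted:
  fixes A :: "nat set"
  assumes "finite A"
  shows "position_weight (map f (sorted_list_of_set A)) = (\<Sum>a\<in>A. int (card {a' \<in> A. a < a'}) * f a)"
  using assms
proof (induction A rule: finite_linorder_max_induct)
  case (insert m A)
  have "{a' \<in> insert m A. a < a'} = insert m {a' \<in> A. a < a'}" if "a \<in> A" for a
    using insert.hyps that by auto
  moreover have "m \<notin> A"
    using insert.hyps by auto
  ultimately have "int (card {a' \<in> insert m A. a < a'}) = int (card {a' \<in> A. a < a'}) + 1" if "a \<in> A" for a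
    using that insert.hyps(1) by simp
  moreover have "{a' \<in> insert m A. m < a'} = {}"
    using insert.hyps by auto
  ultimately show ?case
    using insert \<open>m \<notin> A\<close> sum_list_distinct_conv_sum_set[of "sorted_list_of_set A" f]
      sorted_list_of_set_insert_greatest[of A m]
    by (simp add: position_weight_append algebra_simps sum.distrib
        del: sorted_list_of_set_insert_remove insert_iff)
qed simp

lemma length_tensor_map: "length (tensor_map scale V fs xs) = min (length fs) (length xs)"
  by (induction scale V fs xs rule: tensor_map.induct) auto

text \<open>The Koszul sign is carried by the entry that is passed and depends only on the degrees
  of the later maps, so the other entries are unaffected.\<close>

lemma tensor_map_update:
  assumes "length fs = length xs" "a < length xs"
  shows "tensor_map scale V fs (xs[a := x]) =
    (tensor_map scale V fs xs)[a := fst (fs ! a) (koszul_twist scale V (sum_list (map snd (drop (Suc a) fs))) x)]"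
  using assms
proof (induction fs xs arbitrary: a rule: list_induct2)
  case (Cons f fs y ys)
  then show ?case by (cases f; cases a) auto
qed simp

context dg_leibniz_algebra
begin

sublocale susp: graded_vector_space "susp_scale scale" "susp_grading V"
  by (rule graded_vector_space_susp)

lemma tensor_map_id:
  assumes "list_all2 (\<lambda>u g. u \<in> V g) us gs"
  shows "tensor_map (susp_scale scale) (susp_grading V) (replicate (length us) (id, 0)) (map Susp us) =
    map Susp us"
  using assms
proof induction
  case (Cons u us g gs)
  then show ?case
    using susp.koszul_twist_homogeneous[of "Susp u" "g + 1" 0] by (simp add: sum_list_replicate signed_def)
qed simp

lemma br_signed_right: "br x (signed k y) = signed k (br x y)"
  using linear_bracket_right[of x] by (auto simp: signed_def linear_iff_module_hom module_hom.neg)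

lemma foldl_br_signed: "foldl br (signed k x) us = signed k (foldl br x us)"
  by (induction us arbitrary: x) (simp_all add: br_signed_left)

text \<open>A suspended entry has degree g + 1 and is passed by one desuspension for each later
  entry. The summands g add up to \<open>position_weight\<close>, the summands 1 to a triangular
  number.\<close>

lemma foldl_tensor_map_desusp:
  assumes "list_all2 (\<lambda>u g. u \<in> V g) us gs"
  shows "foldl br x (tensor_map (susp_scale scale) (susp_grading V)
      (replicate (length us) (desusp, - 1)) (map Susp us)) =
    signed (position_weight gs + int (length us * (length us - 1) div 2)) (foldl br x us)"
  using assms
proof (induction arbitrary: x)
  case (Cons u us g gs)
  have triangular: "Suc n * n div 2 = n * (n - 1) div 2 + n" for n :: nat
  proof (cases n)
    case (Suc k)
    have "Suc n * n = n * (n - 1) + n * 2"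
      by (simp add: Suc)
    then show ?thesis by (simp only: div_mult_self1)
  qed simp
  have "length us = length gs"
    using Cons.hyps by (simp add: list_all2_lengthD)
  then show ?case
    using susp.koszul_twist_homogeneous[of "Susp u" "g + 1" "- int (length us)"] Cons triangular[of "length us"]
    by (simp add: sum_list_replicate signed_Susp br_signed_right foldl_br_signed algebra_simps del: mult_Suc)
      (rule signed_cong, auto)
qed (simp add: signed_def)

text \<open>With n = i - 1, the prefactor of the bracket cancels the triangular number from
  desuspending the last n entries. The first entry has degree g + 2 after
  \<open>Susp \<circ> \<delta> n \<circ> desusp\<close>, and passing n desuspensions gives n(g + 2),
  congruent to n g modulo 2.\<close>

lemma derived_bracket_Susp:
  assumes us: "list_all2 (\<lambda>u g. u \<in> V g) us gs" "us \<noteq> []" "length us = i"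
    and \<delta>: "\<And>n x. x \<in> V n \<Longrightarrow> \<delta> (i - 1) x \<in> V (n + 1)"
  shows "derived_bracket scale V br \<delta> i (map Susp us) =
    Susp (signed (position_weight gs) (derived_word br (\<delta> (i - 1)) us))"
proof -
  from us(1,2) obtain u us' g gs' where eq: "us = u # us'" "gs = g # gs'"
    and u: "u \<in> V g" and us': "list_all2 (\<lambda>u g. u \<in> V g) us' gs'"
    by (auto simp: list_all2_Cons1 neq_Nil_conv)
  define n where "n = length us'"
  have i: "i = Suc n" and gs': "length gs' = n"
    using us(3) eq us' by (simp_all add: n_def list_all2_lengthD)
  have "Susp (\<delta> n u) \<in> susp_grading V (g + 2)" "Susp u \<in> susp_grading V (g + 1)"
    using \<delta>[OF u] u i by (simp_all add: add.commute[of 1 g])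
  note twist = this[THEN susp.koszul_twist_homogeneous]
  have c: "susp_scale scale ((- 1) ^ k) (Susp w) = Susp (signed (int k) w)" for k w
    by (simp add: susp_scale_def signed_def)
  have "derived_bracket scale V br \<delta> i (map Susp us) =
      Susp (signed (int (n * (n - 1) div 2) + (- int n * (g + 2))
        + (position_weight gs' + int (n * (n - 1) div 2))) (foldl br (\<delta> n u) us'))"
    using tensor_map_id[OF us'] foldl_tensor_map_desusp[OF us'] twist
    by (simp add: derived_bracket_def i eq iterated_bracket_def c sum_list_replicate signed_Susp foldl_br_signed flip: n_def)
  also have "\<dots> = Susp (signed (position_weight gs) (derived_word br (\<delta> (i - 1)) us))"
    unfolding eq derived_word_def
    by (simp add: i gs' signed_cong)
  finally show ?thesis .
qed

end

section \<open>Composites of derived brackets\<close>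

context dg_leibniz_algebra
begin

text \<open>The terms with k = m + 1: the element k always closes the inner word, and
  \<open>B\<close> holds its other entries.\<close>

definition top_sum where
  "top_sum v f D D' m X =
     (\<Sum>B\<in>X. nested_product br v f D D' ({1..m} - B) (insert (Suc m) B))"

text \<open>The part of the identity with \<open>D\<close> outside and \<open>D'\<close> on an inner
  word of q + 1 entries, freed of the global sign. A new element either follows the inner word or
  closes it.\<close>

primrec composite_sum where
  "composite_sum v f D D' q 0 = 0"
| "composite_sum v f D D' q (Suc m) =
     br (composite_sum v f D D' q m) (v (Suc m)) + top_sum v f D D' m {B. B \<subseteq> {1..m} \<and> card B = q}"

text \<open>Complementing the blocks matches each term with its partner in
  \<open>nested_product_insert_greatest\<close>.\<close>

lemma top_sum_swap:
  assumes "\<And>a. a \<in> {1..m} \<Longrightarrow> v a \<in> V (f a)"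
    and "derivation scale V br 1 D" "derivation scale V br 1 D'" "m \<ge> 1"
    and X: "X \<subseteq> Pow {1..m}"
  shows "top_sum v f D D' m X + top_sum v f D' D m ((\<lambda>B. {1..m} - B) ` X) =
    (\<Sum>B\<in>X. br (nested_product br v f D D' ({1..m} - B) B) (v (Suc m)))"
proof -
  have "top_sum v f D' D m ((\<lambda>B. {1..m} - B) ` X) =
      (\<Sum>B\<in>X. nested_product br v f D' D B (insert (Suc m) ({1..m} - B)))"
    unfolding top_sum_def
    by (subst sum.reindex) (use X in \<open>auto simp: inj_on_def double_diff intro!: sum.cong\<close>)
  moreover have "nested_product br v f D D' ({1..m} - B) (insert (Suc m) B)
      + nested_product br v f D' D B (insert (Suc m) ({1..m} - B))
      = br (nested_product br v f D D' ({1..m} - B) B) (v (Suc m))" if "B \<in> X" for B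
    by (rule nested_product_insert_greatest) (use that assms in auto)
  ultimately show ?thesis
    by (simp add: top_sum_def flip: sum.distrib)
qed

lemma top_sum_Un:
  assumes "X \<inter> Y = {}" "X \<subseteq> Pow {1..m}" "Y \<subseteq> Pow {1..m}"
  shows "top_sum v f D D' m (X \<union> Y) = top_sum v f D D' m X + top_sum v f D D' m Y"
  unfolding top_sum_def
  by (rule sum.union_disjoint[OF finite_subset[OF assms(2)] finite_subset[OF assms(3)] assms(1)]) simp_all

text \<open>The correction terms of \<open>composite_sum_invariant\<close>: they are empty for \<open>q + r = m\<close>, the only case
  of interest, but the induction on \<open>m\<close> at fixed \<open>q\<close> and \<open>r\<close> runs through smaller \<open>m\<close>.\<close>

definition below :: "nat \<Rightarrow> nat \<Rightarrow> nat \<Rightarrow> nat set set" where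
  "below m q r = {B. B \<subseteq> {1..m} \<and> card B < q \<and> m - card B \<le> r}"

text \<open>The sum is split by whether \<open>Suc m\<close> lies in the inner block. If so,
  removing it leaves a block in \<open>below m q r\<close>; if not, swapping the roles of the
  operators makes it inner, with the rest in \<open>below m r q\<close>.\<close>

lemma br_sum_nested_product:
  assumes v: "\<And>a. a \<in> {1..Suc m} \<Longrightarrow> v a \<in> V (f a)"
    and D: "derivation scale V br 1 D" "derivation scale V br 1 D'"
  shows "br (top_sum v f D D' m (below m q r) + top_sum v f D' D m (below m r q)) z =
    (\<Sum>B | B \<subseteq> {1..Suc m} \<and> card B \<le> q \<and> Suc m - card B \<le> r.
       br (nested_product br v f D D' ({1..Suc m} - B) B) z)"
proof -
  let ?g = "\<lambda>B. br (nested_product br v f D D' ({1..Suc m} - B) B) z"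
  let ?X = "{B. B \<subseteq> {1..Suc m} \<and> card B \<le> q \<and> Suc m - card B \<le> r}"
  have fin: "finite B" if "B \<subseteq> {1..m}" for B
    using that finite_subset by blast
  have X: "?X = insert (Suc m) ` below m q r \<union> (\<lambda>A. {1..m} - A) ` below m r q" (is "_ = ?Y \<union> ?Z")
  proof (intro equalityI subsetI)
    fix B assume B: "B \<in> ?X"
    then have finB: "finite B" using finite_subset by blast
    show "B \<in> ?Y \<union> ?Z"
    proof (cases "Suc m \<in> B")
      case True
      have "card B = Suc (card (B - {Suc m}))"
        using True finB by (metis card.remove)
      then have "B - {Suc m} \<in> below m q r"
        using B by (auto simp: below_def)
      then show ?thesis
        using True by (auto intro!: image_eqI[of _ _ "B - {Suc m}"])
    next
      case False
      then have sub: "B \<subseteq> {1..m}"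
        using B by (auto simp: subset_iff) (metis le_SucE)
      then have "card B \<le> m"
        using card_mono[of "{1..m}" B] by simp
      then have "{1..m} - B \<in> below m r q"
        using B sub finB by (auto simp: below_def card_Diff_subset)
      then show ?thesis
        using sub by (auto intro!: image_eqI[of _ _ "{1..m} - B"])
    qed
  next
    fix B assume "B \<in> ?Y \<union> ?Z"
    then show "B \<in> ?X"
    proof
      assume "B \<in> ?Y"
      then obtain C where C: "C \<in> below m q r" "B = insert (Suc m) C" by auto
      then have "Suc m \<notin> C" "finite C" using fin by (auto simp: below_def)
      then show ?thesis using C by (auto simp: below_def)
    next
      assume "B \<in> ?Z"
      then obtain C where C: "C \<in> below m r q" "B = {1..m} - C" by auto
      then have "finite C" "card C \<le> m"
        using fin card_mono[of "{1..m}" C] by (auto simp: below_def)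
      then show ?thesis using C by (auto simp: below_def card_Diff_subset)
    qed
  qed
  have "finite ?X"
    by (rule finite_subset[of _ "Pow {1..Suc m}"]) auto
  then have finYZ: "finite ?Y" "finite ?Z"
    unfolding X by (simp_all only: finite_Un)
  have "Suc m \<in> B" if "B \<in> ?Y" for B
    using that by blast
  moreover have "Suc m \<notin> B" if "B \<in> ?Z" for B
    using that by auto
  ultimately have disj: "?Y \<inter> ?Z = {}"
    by blast
  have "(\<Sum>B\<in>?X. ?g B) = (\<Sum>B\<in>?Y. ?g B) + (\<Sum>B\<in>?Z. ?g B)"
    unfolding X by (rule sum.union_disjoint[OF finYZ disj])
  also have "(\<Sum>B\<in>?Y. ?g B) = br (top_sum v f D D' m (below m q r)) z"
  proof -
    have "inj_on (insert (Suc m)) (below m q r)"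
      by (rule inj_on_inverseI[of _ "\<lambda>B. B - {Suc m}"]) (auto simp: below_def)
    moreover have "{1..Suc m} - insert (Suc m) B = {1..m} - B" for B
      by auto
    ultimately show ?thesis
      by (simp add: sum.reindex top_sum_def br_sum_left)
  qed
  also have "(\<Sum>B\<in>?Z. ?g B) = br (top_sum v f D' D m (below m r q)) z"
  proof -
    have "inj_on (\<lambda>A. {1..m} - A) (below m r q)"
      by (rule inj_onI) (auto simp: below_def)
    \<comment> \<open>The swap is legitimate because both nested products act from the left on
      \<open>z\<close>.\<close>
    moreover have "?g ({1..m} - B) = br (nested_product br v f D' D ({1..m} - B) (insert (Suc m) B)) z"
      if "B \<in> below m r q" for B
    proof -
      have "{1..Suc m} - ({1..m} - B) = insert (Suc m) B"
        using that by (auto simp: below_def)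
      moreover have "insert (Suc m) B \<inter> ({1..m} - B) = {}" "insert (Suc m) B \<union> ({1..m} - B) = {1..Suc m}"
        using that by (auto simp: below_def)
      ultimately show ?thesis
        using nested_product_swap[OF v D] by simp
    qed
    ultimately show ?thesis
      by (simp add: sum.reindex top_sum_def br_sum_left)
  qed
  finally show ?thesis
    by (simp add: br_add_left)
qed

text \<open>In the induction step the blocks of size q and those in \<open>below\<close> form the
  family \<open>?X\<close>. By \<open>top_sum_swap\<close> and \<open>br_sum_nested_product\<close>
  its two top sums reduce to the previous correction terms bracketed with the new element, so the
  whole left side is bracketed with it.\<close>

lemma composite_sum_invariant:
  assumes "\<And>a. a \<in> {1..Suc m} \<Longrightarrow> v a \<in> V (f a)"
    and D: "derivation scale V br 1 D" "derivation scale V br 1 D'" and "m \<le> q + r"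
  shows "composite_sum v f D D' q (Suc m) + composite_sum v f D' D r (Suc m)
      + (top_sum v f D D' m (below m q r) + top_sum v f D' D m (below m r q)) =
    foldl br (D (D' (v 1)) + D' (D (v 1))) (map v [2..<Suc (Suc m)])"
  using assms(1,4)
proof (induction m)
  case 0
  \<comment> \<open>The only block is the empty one; it lies in the first family if q = 0 and in
    \<open>below\<close> otherwise.\<close>
  have "top_sum v f E E' 0 {B. B \<subseteq> {1..0} \<and> card B = q} + top_sum v f E E' 0 (below 0 q r) =
      E (E' (v 1))" for E E' q r
  proof (cases "q = 0")
    case True
    then have "{B. B \<subseteq> {1..0::nat} \<and> card B = q} = {{}}" "below 0 q r = {}"
      by (auto simp: below_def)
    then show ?thesis
      by (simp only: top_sum_def) (simp add: nested_product_def)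
  next
    case False
    then have "{B. B \<subseteq> {1..0::nat} \<and> card B = q} = {}" "below 0 q r = {{}}"
      by (auto simp: below_def)
    then show ?thesis
      by (simp only: top_sum_def) (simp add: nested_product_def)
  qed
  from this[of D D' q r] this[of D' D r q] show ?case
    by (simp add: algebra_simps)
next
  case (Suc m)
  let ?n = "Suc m" and ?v = "v (Suc (Suc m))"
  let ?X = "\<lambda>q r. {B. B \<subseteq> {1..?n} \<and> card B \<le> q \<and> ?n - card B \<le> r}"
  \<comment> \<open>A block of size q satisfies the bound on its complement because
    \<open>?n \<le> q + r\<close>.\<close>
  have split: "top_sum v f E E' ?n (?X q r) =
      top_sum v f E E' ?n {B. B \<subseteq> {1..?n} \<and> card B = q} + top_sum v f E E' ?n (below ?n q r)"
    if "?n \<le> q + r" for E E' q r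
  proof -
    have "?X q r = {B. B \<subseteq> {1..?n} \<and> card B = q} \<union> below ?n q r" (is "_ = ?E \<union> _")
      using that by (auto simp: below_def)
    moreover have "?E \<inter> below ?n q r = {}" "?E \<subseteq> Pow {1..?n}" "below ?n q r \<subseteq> Pow {1..?n}"
      by (auto simp: below_def)
    ultimately show ?thesis
      by (simp only: top_sum_Un)
  qed
  have compl: "{1..?n} - B \<in> ?X r q" if "B \<in> ?X q r" for B q r
  proof -
    have "card B \<le> ?n" "finite B"
      using that card_mono[of "{1..?n}" B] finite_subset[of B "{1..?n}"] by auto
    then show ?thesis
      using that by (auto simp: card_Diff_subset)
  qed
  have image: "(\<lambda>B. {1..?n} - B) ` ?X q r = ?X r q"
  proof (intro equalityI subsetI)
    fix B assume "B \<in> ?X r q"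
    then show "B \<in> (\<lambda>B. {1..?n} - B) ` ?X q r"
      using compl[of B r q] by (intro image_eqI[of _ _ "{1..?n} - B"]) auto
  next
    fix B assume "B \<in> (\<lambda>B. {1..?n} - B) ` ?X q r"
    then show "B \<in> ?X r q"
      using compl[of _ q r] by (elim imageE) simp
  qed
  have "top_sum v f D D' ?n (?X q r) + top_sum v f D' D ?n (?X r q) =
      (\<Sum>B\<in>?X q r. br (nested_product br v f D D' ({1..?n} - B) B) ?v)"
    using top_sum_swap[of ?n v f D D' "?X q r", unfolded image] D Suc.prems(1) by auto
  also have "\<dots> = br (top_sum v f D D' m (below m q r) + top_sum v f D' D m (below m r q)) ?v"
    by (rule br_sum_nested_product[symmetric]) (use D Suc.prems(1) in auto)
  finally have "top_sum v f D D' ?n (?X q r) + top_sum v f D' D ?n (?X r q) =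
      br (top_sum v f D D' m (below m q r) + top_sum v f D' D m (below m r q)) ?v" .
  moreover have "foldl br (D (D' (v 1)) + D' (D (v 1))) (map v [2..<Suc (Suc ?n)]) =
      br (composite_sum v f D D' q ?n + composite_sum v f D' D r ?n
        + (top_sum v f D D' m (below m q r) + top_sum v f D' D m (below m r q))) ?v"
    using Suc.IH Suc.prems by simp
  ultimately show ?case
    using split[of q r D D'] split[of r q D' D] Suc.prems
    by (simp add: br_add_left ac_simps)
qed

lemma composite_sum_commutator:
  assumes "\<And>a. a \<in> {1..n} \<Longrightarrow> v a \<in> V (f a)"
    and "derivation scale V br 1 D" "derivation scale V br 1 D'" and "n = Suc (q + r)"
  shows "composite_sum v f D D' q n + composite_sum v f D' D r n =
    foldl br (D (D' (v 1)) + D' (D (v 1))) (map v [2..<Suc n])"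
proof -
  have "below (q + r) q r = {}" "below (q + r) r q = {}"
    by (auto simp: below_def)
  then show ?thesis
    using composite_sum_invariant[of "q + r" v f D D' q r] assms by (simp add: top_sum_def)
qed

text \<open>The unfolded recursion; k starts at q + 1 because q inner entries must precede
  it.\<close>

lemma composite_sum_eq:
  "composite_sum v f D D' q n =
    (\<Sum>k = Suc q..n. foldl br (top_sum v f D D' (k - 1) {B. B \<subseteq> {1..k - 1} \<and> card B = q})
       (map v [Suc k..<Suc n]))"
proof (induction n)
  case (Suc n)
  show ?case
  proof (cases "q \<le> n")
    case True
    have "br (composite_sum v f D D' q n) (v (Suc n)) =
      (\<Sum>k = Suc q..n. foldl br (top_sum v f D D' (k - 1) {B. B \<subseteq> {1..k - 1} \<and> card B = q})
       (map v [Suc k..<Suc (Suc n)]))"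
      unfolding Suc.IH br_sum_left by (rule sum.cong) auto
    with True show ?thesis by simp
  next
    case False
    then have "{B. B \<subseteq> {1..n} \<and> card B = q} = {}"
      using card_mono[of "{1..n}"] by fastforce
    then have "top_sum v f D D' n {B. B \<subseteq> {1..n} \<and> card B = q} = 0"
      by (simp only: top_sum_def sum.empty)
    with False Suc.IH show ?thesis by simp
  qed
qed simp

section \<open>Multilinearity and degree of the derived brackets\<close>

lemma foldl_br_add: "foldl br (x + y) us = foldl br x us + foldl br y us"
  by (induction us arbitrary: x y) (simp_all add: br_add_left)

lemma foldl_br_zero [simp]: "foldl br 0 us = 0"
  by (induction us) simp_all

lemma foldl_br_sum: "foldl br (\<Sum>x\<in>X. g x) us = (\<Sum>x\<in>X. foldl br (g x) us)"
  by (induction X rule: infinite_finite_induct) (simp_all add: foldl_br_add)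

lemma linear_foldl_br: "Vector_Spaces.linear scale scale (\<lambda>x. foldl br x us)"
proof (induction us)
  case Nil
  show ?case by (simp add: linear_id[unfolded id_def])
next
  case (Cons u us)
  from Vector_Spaces.linear_compose[OF linear_bracket_left Cons] show ?case
    by (simp add: o_def)
qed

lemma linear_foldl_br_update:
  assumes "a < length us"
  shows "Vector_Spaces.linear scale scale (\<lambda>u. foldl br x (us[a := u]))"
  using assms
proof (induction us arbitrary: a x)
  case (Cons w us)
  show ?case
  proof (cases a)
    case 0
    then show ?thesis
      using Vector_Spaces.linear_compose[OF linear_bracket_right[of x] linear_foldl_br[of us]] by (simp add: o_def)
  qed (use Cons in simp)
qed simp

lemma linear_iterated_bracket:
  assumes "a < length us"
  shows "Vector_Spaces.linear scale scale (\<lambda>u. iterated_bracket br (us[a := u]))"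
proof (cases us)
  case (Cons w ws)
  then show ?thesis
    using assms linear_foldl_br linear_foldl_br_update[of "a - 1" ws w]
    by (cases a) (simp_all add: iterated_bracket_def)
qed (use assms in simp)

lemma linear_desusp: "Vector_Spaces.linear (susp_scale scale) scale desusp"
  and linear_Susp: "Vector_Spaces.linear scale (susp_scale scale) Susp"
  and linear_susp_scale: "Vector_Spaces.linear (susp_scale scale) (susp_scale scale) (susp_scale scale c)"
  by (simp_all add: Vector_Spaces.linear_iff vector_space_axioms vector_space_susp
      susp_scale_def plus_suspension_def scale_right_distrib mult.commute)

text \<open>As a function of one entry the bracket is a composite of linear maps, since both tensor
  maps change that entry alone.\<close>

lemma multilinear_derived_bracket:
  assumes "i \<ge> 1" and \<delta>: "Vector_Spaces.linear scale scale (\<delta> (i - 1))"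
  shows "multilinear (susp_scale scale) i (derived_bracket scale V br \<delta> i)"
  unfolding multilinear_def
proof (intro allI impI)
  fix xs :: "'v suspension list" and a assume xs: "length xs = i" "a < i"
  let ?fs = "(Susp \<circ> \<delta> (i - 1) \<circ> desusp, 1 :: int) # replicate (i - 1) (id, 0)"
  let ?gs = "replicate i (desusp :: 'v suspension \<Rightarrow> 'v, - 1 :: int)"
  let ?kt = "koszul_twist (susp_scale scale) (susp_grading V)"
  let ?ys = "tensor_map (susp_scale scale) (susp_grading V) ?gs
    (tensor_map (susp_scale scale) (susp_grading V) ?fs xs)"
  \<comment> \<open>The total degrees of the maps after position \<open>a\<close>, which determine
    the twists of that entry in the two tensor maps.\<close>
  define k where "k = sum_list (map snd (drop (Suc a) ?fs))"
  define l where "l = sum_list (map snd (drop (Suc a) ?gs))"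
  define c where "c = ((- 1) ^ ((i - 1) * (i - 2) div 2) :: 'k)"
  have len: "length ?fs = i" "length ?ys = i"
    using assms(1) xs by (simp_all add: length_tensor_map)
  have f: "Vector_Spaces.linear (susp_scale scale) (susp_scale scale) (fst (?fs ! a))"
  proof (cases a)
    case 0
    then show ?thesis
      using Vector_Spaces.linear_compose[OF linear_desusp Vector_Spaces.linear_compose[OF \<delta> linear_Susp]]
      by (simp add: o_assoc)
  next
    case (Suc b)
    then show ?thesis
      using xs by (simp add: susp.linear_id)
  qed
  have "derived_bracket scale V br \<delta> i (xs[a := x]) =
      (susp_scale scale c \<circ> (Susp \<circ> ((\<lambda>u. iterated_bracket br (?ys[a := u])) \<circ>
        (desusp \<circ> (?kt l \<circ> (fst (?fs ! a) \<circ> ?kt k)))))) x" for x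
    using xs len tensor_map_update[of ?fs xs a "susp_scale scale" "susp_grading V" x]
    by (simp add: derived_bracket_def tensor_map_update length_tensor_map k_def l_def c_def)
  moreover have "Vector_Spaces.linear (susp_scale scale) (susp_scale scale)
      (susp_scale scale c \<circ> (Susp \<circ> ((\<lambda>u. iterated_bracket br (?ys[a := u])) \<circ>
        (desusp \<circ> (?kt l \<circ> (fst (?fs ! a) \<circ> ?kt k))))))"
    using len xs f
    by (intro Vector_Spaces.linear_compose[of _ scale] Vector_Spaces.linear_compose[of _ "susp_scale scale"]
        linear_susp_scale linear_Susp linear_iterated_bracket linear_desusp susp.linear_koszul_twist) simp_all
  ultimately show "Vector_Spaces.linear (susp_scale scale) (susp_scale scale)
      (\<lambda>x. derived_bracket scale V br \<delta> i (xs[a := x]))"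
    by presburger
qed

lemma signed_mem: "u \<in> V n \<Longrightarrow> signed k u \<in> V n"
  using subspace_neg[OF subspace_component] by (simp add: signed_def)

lemma foldl_br_degree:
  assumes "list_all2 (\<lambda>u g. u \<in> V g) us gs" "x \<in> V m"
  shows "foldl br x us \<in> V (m + sum_list gs)"
  using assms
proof (induction arbitrary: x m)
  case (Cons u us g gs)
  then show ?case
    using Cons.IH[OF degree_bracket[OF Cons.prems Cons.hyps(1)]] by (simp add: add.assoc)
qed simp

lemma derived_word_degree:
  assumes "list_all2 (\<lambda>u g. u \<in> V g) us gs" "us \<noteq> []"
    and "\<And>n x. x \<in> V n \<Longrightarrow> D x \<in> V (n + k)"
  shows "derived_word br D us \<in> V (sum_list gs + k)"
proof -
  from assms(1,2) obtain u us' g gs' where eq: "us = u # us'" "gs = g # gs'"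
    and "u \<in> V g" and us': "list_all2 (\<lambda>u g. u \<in> V g) us' gs'"
    by (auto simp: list_all2_Cons1 neq_Nil_conv)
  then show ?thesis
    using foldl_br_degree[OF us' assms(3), of u g] by (simp add: derived_word_def algebra_simps)
qed

end

section \<open>The sh Leibniz identity for a square-zero deformation\<close>

locale square_zero_deformation = dg_leibniz_algebra scale V d br
  for scale :: "'k::field_char_0 \<Rightarrow> 'v::ab_group_add \<Rightarrow> 'v" and V d br +
  fixes \<delta> :: "nat \<Rightarrow> 'v \<Rightarrow> 'v"
  assumes derivation_coefficient: "derivation scale V br 1 (\<delta> i)"
    and square_zero: "(\<Sum>i\<le>m. \<delta> i (\<delta> (m - i) u)) = 0"
begin

lemma linear_coefficient: "Vector_Spaces.linear scale scale (\<delta> i)"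
  and degree_coefficient: "u \<in> V n \<Longrightarrow> \<delta> i u \<in> V (n + 1)"
  using derivation_coefficient[of i] by (auto simp: derivation_def)

lemma coefficient_signed: "\<delta> i (signed k u) = signed k (\<delta> i u)"
  using linear_coefficient[of i] by (auto simp: signed_def linear_iff_module_hom module_hom.neg)

text \<open>The i desuspensions lower the degree by i, while the coefficient of the deformation and
  the final suspension raise it by 1 each.\<close>

lemma degree_derived_bracket:
  assumes "1 \<le> i" "\<And>a. a \<in> {1..i} \<Longrightarrow> x a \<in> susp_grading V (e a)"
  shows "derived_bracket scale V br \<delta> i (map x [1..<i+1]) \<in> susp_grading V ((\<Sum>a = 1..i. e a) + (2 - int i))"
proof -
  let ?us = "map (desusp \<circ> x) [1..<i+1]" and ?gs = "map (\<lambda>a. e a - 1) [1..<i+1]"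
  have "(desusp \<circ> x) a \<in> V (e a - 1)" if "a \<in> {1..i}" for a
    using assms(2)[OF that] by (auto simp: susp_grading_def)
  then have us: "list_all2 (\<lambda>u g. u \<in> V g) ?us ?gs"
    by (auto simp: list_all2_map1 list_all2_map2 list_all2_same simp del: upt_Suc)
  have "sum_list ?gs = (\<Sum>a = 1..i. e a - 1)"
    by (simp add: interv_sum_list_conv_sum_set_nat atLeastLessThanSuc_atLeastAtMost del: upt_Suc)
  then have "sum_list ?gs + 1 = (\<Sum>a = 1..i. e a) + (2 - int i) - 1"
    by (simp add: sum_subtractf)
  then have "derived_word br (\<delta> (i - 1)) ?us \<in> V ((\<Sum>a = 1..i. e a) + (2 - int i) - 1)"
    using derived_word_degree[OF us _ degree_coefficient[of _ _ "i - 1"]] assms(1) by simp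
  then show ?thesis
    using derived_bracket_Susp[of ?us ?gs i \<delta>, OF us _ _ degree_coefficient] assms(1) signed_mem
    by (simp add: comp_def)
qed

text \<open>Here \<open>\<alpha>\<close> elements precede the inner bracket and \<open>r\<close> follow it. The two signs differ by
  \<open>2 * (SAB + \<alpha> * q)\<close> in the exponent.\<close>

lemma bracket_term:
  fixes v :: "nat \<Rightarrow> 'v" and f e :: "nat \<Rightarrow> int" and \<alpha> p q r :: nat
  defines "k \<equiv> \<alpha> + q + 1" and "p \<equiv> \<alpha> + r"
  defines "n \<equiv> p + q + 1"
  assumes v: "\<And>a. a \<in> {1..n} \<Longrightarrow> v a \<in> V (f a)" and e: "\<And>a. e a = f a + 1"
    and \<sigma>: "\<sigma> \<in> unshuffles \<alpha> q"
  defines "B \<equiv> \<sigma> ` {\<alpha>+1..\<alpha>+q}"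
  shows "susp_scale scale (chi (\<alpha> + q) \<sigma> e * (-1) ^ ((\<alpha> + 1) * q) * (-1) powi (int (q + 1) * (\<Sum>a = 1..\<alpha>. e (\<sigma> a))))
      (derived_bracket scale V br \<delta> (p + 1)
        (map (\<lambda>a. Susp (v (\<sigma> a))) [1..<\<alpha>+1]
          @ [derived_bracket scale V br \<delta> (q + 1) (map (\<lambda>a. Susp (v (\<sigma> a))) [\<alpha>+1..<\<alpha>+q+1] @ [Susp (v k)])]
          @ map (\<lambda>a. Susp (v a)) [k+1..<n+1])) =
    Susp (signed (int (n - 1) + (\<Sum>a = 1..n. int (n - a) * f a))
      (foldl br (nested_product br v f (\<delta> p) (\<delta> q) ({1..k-1} - B) (insert k B)) (map v [k+1..<n+1])))"
proof -
  define A where "A = \<sigma> ` {1..\<alpha>}"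
  have A: "A = {1..k-1} - B" and B: "B \<subseteq> {1..k-1}" and card: "card A = \<alpha>" "card B = q"
    and as: "map \<sigma> [1..<\<alpha>+1] = sorted_list_of_set A" and bs: "map \<sigma> [\<alpha>+1..<\<alpha>+q+1] = sorted_list_of_set B"
    using unshuffle_blocks[OF \<sigma>] by (simp_all add: A_def B_def k_def)
  have fin: "finite A" "finite B"
    by (simp_all add: A_def B_def)
  have lt: "a < k" if "a \<in> A \<union> B" for a
    using that A B by (auto simp: k_def)
  have in_n: "a \<in> {1..n}" if "a \<in> A \<union> B" for a
    using that A B by (auto simp: k_def n_def p_def)
  have kn: "k \<in> {1..n}" "n = k + r"
    by (auto simp: k_def n_def p_def)
  define u where "u = derived_product br v (\<delta> q) (insert k B)"
  define w1 where "w1 = position_weight (map f (sorted_list_of_set B) @ [f k])"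
  \<comment> \<open>The degree of the unsuspended inner word, with 1 added for
    \<open>\<delta> q\<close>.\<close>
  define g where "g = sum f B + f k + 1"
  have u: "u \<in> V g"
  proof -
    have "k \<notin> B" using lt by blast
    moreover have "u \<in> V (sum f (insert k B) + 1)"
      unfolding u_def by (rule derived_product_degree) (use fin v in_n kn degree_coefficient in auto)
    ultimately show ?thesis
      using fin by (simp add: g_def add.commute)
  qed
  have mem: "list_all2 (\<lambda>u g. u \<in> V g) (map v as) (map f as)" if "set as \<subseteq> {1..n}" for as
    using that v by (auto simp: list_all2_map1 list_all2_map2 list_all2_same)
  have inner: "derived_bracket scale V br \<delta> (q + 1) (map (\<lambda>a. Susp (v (\<sigma> a))) [\<alpha>+1..<\<alpha>+q+1] @ [Susp (v k)]) =
      Susp (signed w1 u)"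
  proof -
    have "set (sorted_list_of_set B @ [k]) \<subseteq> {1..n}"
      using fin in_n kn(1) by auto
    from mem[OF this]
    have "list_all2 (\<lambda>u g. u \<in> V g) (map v (sorted_list_of_set B) @ [v k]) (map f (sorted_list_of_set B) @ [f k])"
      by simp
    from derived_bracket_Susp[of _ _ "q + 1" \<delta>, OF this _ _ degree_coefficient] card
    have "derived_bracket scale V br \<delta> (q + 1) (map Susp (map v (sorted_list_of_set B) @ [v k])) =
        Susp (signed w1 (derived_word br (\<delta> q) (map v (sorted_list_of_set B) @ [v k])))"
      by (simp add: w1_def)
    moreover have "map v (sorted_list_of_set B) @ [v k] = map v (sorted_list_of_set (insert k B))"
      using sorted_list_of_set_insert_greatest[of B k] fin lt by simp
    ultimately show ?thesis
      by (simp add: u_def derived_product_def comp_def flip: bs del: upt_Suc)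
  qed
  define X where "X = (if A = {} then \<delta> p u else br (derived_product br v (\<delta> p) A) u)"
  define rest where "rest = map v [k+1..<n+1]"
  define w2 where "w2 = position_weight (map f (sorted_list_of_set A) @ [g] @ map f [k+1..<n+1])"
  have outer: "derived_bracket scale V br \<delta> (p + 1) (map (\<lambda>a. Susp (v (\<sigma> a))) [1..<\<alpha>+1]
        @ [Susp (signed w1 u)] @ map (\<lambda>a. Susp (v a)) [k+1..<n+1]) =
      Susp (signed (w2 + w1) (foldl br X rest))"
  proof -
    let ?us = "map v (sorted_list_of_set A) @ [signed w1 u] @ rest"
    have "list_all2 (\<lambda>u g. u \<in> V g) ?us
        (map f (sorted_list_of_set A) @ [g] @ map f [k+1..<n+1])"
      unfolding rest_def using fin in_n u signed_mem
      by (intro list_all2_appendI mem) auto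
    moreover have "length ?us = p + 1"
      using card kn(2) by (simp add: rest_def p_def)
    ultimately have "derived_bracket scale V br \<delta> (p + 1) (map Susp ?us) =
        Susp (signed w2 (derived_word br (\<delta> p) ?us))"
      using derived_bracket_Susp[of ?us _ "p + 1" \<delta>, OF _ _ _ degree_coefficient] by (simp add: w2_def)
    moreover have "derived_word br (\<delta> p) ?us = signed w1 (foldl br X rest)"
    proof (cases "sorted_list_of_set A")
      case Nil
      then show ?thesis
        using fin by (simp add: X_def derived_word_def coefficient_signed foldl_br_signed)
    next
      case (Cons a as)
      then have "A \<noteq> {}" by auto
      then show ?thesis
        using Cons by (simp add: X_def derived_word_def derived_product_def br_signed_right foldl_br_signed)
    qed
    moreover have "map (\<lambda>a. Susp (v (\<sigma> a))) [1..<\<alpha>+1] = map Susp (map v (sorted_list_of_set A))"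
      by (simp flip: as del: upt_Suc)
    ultimately show ?thesis
      by (simp add: rest_def comp_def del: upt_Suc)
  qed
  \<comment> \<open>For empty \<open>A\<close> the exponent is 0, in agreement with the first branch
    of \<open>nested_product\<close>.\<close>
  have nested: "nested_product br v f (\<delta> p) (\<delta> q) A (insert k B) =
      signed (inversion_degree f A B + sum f A) X"
    using inversion_degree_insert_greatest[of A k f B] lt
    by (simp add: nested_product_def X_def u_def) (simp add: inversion_degree_def signed_def)
  define SA where "SA = (\<Sum>a\<in>A. int (card {a' \<in> A. a < a'}) * f a)"
  define SB where "SB = (\<Sum>b\<in>B. int (card {b' \<in> B. b < b'}) * f b)"
  define SAB where "SAB = (\<Sum>a\<in>A. int (card {b \<in> B. b < a}) * f a)"
  define SBA where "SBA = (\<Sum>b\<in>B. int (card {a \<in> A. b < a}) * f b)"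
  define R where "R = (\<Sum>a\<in>{k+1..<n+1}. int (n - a) * f a)"
  have R: "position_weight (map f [k+1..<n+1]) = R"
  proof -
    have "position_weight (map f [k+1..<n+1]) =
        (\<Sum>a\<in>{k+1..<n+1}. int (card {a' \<in> {k+1..<n+1}. a < a'}) * f a)"
      using position_weight_sorted[of "{k+1..<n+1}" f]
      by (simp only: sorted_list_of_set_range finite_atLeastLessThan)
    also have "\<dots> = R"
      unfolding R_def
    proof (rule sum.cong[OF refl])
      fix a assume "a \<in> {k+1..<n+1}"
      then have "{a' \<in> {k+1..<n+1}. a < a'} = {a<..n}"
        by auto
      then show "int (card {a' \<in> {k+1..<n+1}. a < a'}) * f a = int (n - a) * f a"
        by (simp only: card_greaterThanAtMost)
    qed
    finally show ?thesis .
  qed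
  have sums: "sum_list (map f (sorted_list_of_set C)) = sum f C" if "finite C" for C
    using that sum_list_distinct_conv_sum_set[of "sorted_list_of_set C" f] by simp
  have w1: "w1 = SB + sum f B"
    using fin by (simp add: w1_def position_weight_append position_weight_sorted SB_def sums)
  have w2: "w2 = SA + (1 + int r) * sum f A + int r * g + R"
    unfolding w2_def position_weight_append
    using fin kn(2) R by (simp add: position_weight_sorted SA_def sums algebra_simps del: upt_Suc)
  have above: "card {a \<in> A. c < a} + card {b \<in> B. c < b} = k - 1 - c" if "c < k" for c
  proof -
    have "card {a \<in> A. c < a} + card {b \<in> B. c < b} = card ({a \<in> A. c < a} \<union> {b \<in> B. c < b})"
      using fin A by (intro card_Un_disjoint[symmetric]) auto
    also have "{a \<in> A. c < a} \<union> {b \<in> B. c < b} = {c<..k-1}"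
      using A B by auto
    finally show ?thesis by simp
  qed
  have split: "card {b \<in> B. b < c} + card {b \<in> B. c < b} = q" if "c \<in> A" for c
  proof -
    have "card {b \<in> B. b < c} + card {b \<in> B. c < b} = card ({b \<in> B. b < c} \<union> {b \<in> B. c < b})"
      using fin by (intro card_Un_disjoint[symmetric]) auto
    also have "{b \<in> B. b < c} \<union> {b \<in> B. c < b} = B"
      using that A by (auto simp: neq_iff)
    finally show ?thesis by (simp add: card)
  qed
  \<comment> \<open>The elements after \<open>a\<close> are the r last ones, k, the larger ones of
    \<open>A\<close> and the larger ones of \<open>B\<close>; the last number is q minus that of the
    smaller ones.\<close>
  have sumA: "(\<Sum>a\<in>A. int (n - a) * f a) = (int r + 1 + int q) * sum f A + SA - SAB"
  proof -
    have "int (n - a) = (int r + 1 + int q) + int (card {a' \<in> A. a < a'}) - int (card {b \<in> B. b < a})" if "a \<in> A" for a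
      using above[of a] split[OF that] lt[of a] that kn(2) by auto
    then have "(\<Sum>a\<in>A. int (n - a) * f a) = (\<Sum>a\<in>A. ((int r + 1 + int q) + int (card {a' \<in> A. a < a'}) - int (card {b \<in> B. b < a})) * f a)"
      by (intro sum.cong) auto
    then show ?thesis
      by (simp add: SA_def SAB_def sum.distrib sum_subtractf sum_distrib_left algebra_simps)
  qed
  have sumB: "(\<Sum>b\<in>B. int (n - b) * f b) = (int r + 1) * sum f B + SB + SBA"
  proof -
    have "int (n - b) = (int r + 1) + int (card {b' \<in> B. b < b'}) + int (card {a \<in> A. b < a})" if "b \<in> B" for b
      using above[of b] lt[of b] that kn(2) by auto
    then have "(\<Sum>b\<in>B. int (n - b) * f b) = (\<Sum>b\<in>B. ((int r + 1) + int (card {b' \<in> B. b < b'}) + int (card {a \<in> A. b < a})) * f b)"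
      by (intro sum.cong) auto
    then show ?thesis
      by (simp add: SB_def SBA_def sum.distrib sum_distrib_left algebra_simps)
  qed
  have total: "(\<Sum>a = 1..n. int (n - a) * f a) =
      (\<Sum>a\<in>A. int (n - a) * f a) + (\<Sum>b\<in>B. int (n - b) * f b) + int r * f k + R"
  proof -
    have "{1..n} = (A \<union> B) \<union> insert k {k+1..<n+1}"
      using A B kn by (auto simp: k_def)
    also have "(\<Sum>a\<in>\<dots>. int (n - a) * f a) = (\<Sum>a\<in>A \<union> B. int (n - a) * f a) + (\<Sum>a\<in>insert k {k+1..<n+1}. int (n - a) * f a)"
      using fin lt by (intro sum.union_disjoint) fastforce+
    also have "(\<Sum>a\<in>A \<union> B. int (n - a) * f a) = (\<Sum>a\<in>A. int (n - a) * f a) + (\<Sum>b\<in>B. int (n - b) * f b)"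
      using fin A by (intro sum.union_disjoint) auto
    finally show ?thesis
      using kn(2) by (simp add: R_def)
  qed
  have sum_e: "(\<Sum>a = 1..\<alpha>. e (\<sigma> a)) = sum f A + int \<alpha>"
  proof -
    have "\<sigma> permutes {1..\<alpha>+q}"
      using \<sigma> by (simp add: unshuffles_def)
    then have "inj_on \<sigma> {1..\<alpha>}"
      using permutes_inj inj_on_subset by blast
    then have "sum f A = (\<Sum>a = 1..\<alpha>. f (\<sigma> a))"
      unfolding A_def by (simp add: sum.reindex)
    then show ?thesis
      by (simp add: e sum.distrib)
  qed
  \<comment> \<open>The exponent of the coefficient: \<open>chi_unshuffle\<close>, then (k + 1 -
    j)(j - 1) with k + 1 - j = \<alpha> + 1 and j - 1 = q, then j times the suspended degrees in
    front.\<close>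
  define E where "E = (inversion_degree f A B + SAB + SBA) + int ((\<alpha> + 1) * q) + int (q + 1) * (sum f A + int \<alpha>)"
  have coefficient: "susp_scale scale (chi (\<alpha> + q) \<sigma> e * (-1) ^ ((\<alpha> + 1) * q) * (-1) powi (int (q + 1) * (\<Sum>a = 1..\<alpha>. e (\<sigma> a)))) (Susp z)
      = Susp (signed E z)" for z
  proof -
    have "chi (\<alpha> + q) \<sigma> e * (-1) ^ ((\<alpha> + 1) * q) * (-1) powi (int (q + 1) * (\<Sum>a = 1..\<alpha>. e (\<sigma> a))) = ((-1) powi E :: 'k)"
      unfolding chi_unshuffle[OF \<sigma>, of e f, OF e, folded A_def B_def] sum_e E_def
      by (simp add: power_int_add SAB_def SBA_def flip: power_int_of_nat)
    then show ?thesis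
      by (simp only: susp_scale_def scale_signed suspension.sel)
  qed
  have "signed (E + (w2 + w1)) z = signed (int (n - 1) + (\<Sum>a = 1..n. int (n - a) * f a) + (inversion_degree f A B + sum f A)) z" for z :: 'v
  proof (rule signed_cong)
    have "int (n - 1) = int \<alpha> + int q + int r"
      by (simp add: n_def p_def)
    then have "E + (w2 + w1) - (int (n - 1) + (\<Sum>a = 1..n. int (n - a) * f a) + (inversion_degree f A B + sum f A))
        = 2 * (SAB + int (\<alpha> * q))"
      unfolding total sumA sumB w1 w2 E_def g_def by (simp add: algebra_simps)
    then show "even (E + (w2 + w1) - (int (n - 1) + (\<Sum>a = 1..n. int (n - a) * f a) + (inversion_degree f A B + sum f A)))"
      by simp
  qed
  then show ?thesis
    unfolding inner outer coefficient A[symmetric] nested foldl_br_signed signed_signed rest_def[symmetric]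
    by simp
qed

text \<open>The sign in \<open>bracket_term\<close> does not depend on the unshuffle, so it factors
  out and the sum can be reindexed by inner blocks.\<close>

lemma sum_unshuffles_bracket_term:
  fixes x :: "nat \<Rightarrow> 'v suspension"
  assumes x: "\<And>a. a \<in> {1..n} \<Longrightarrow> x a \<in> susp_grading V (e a)"
    and ij: "i + j = n + 1" "1 \<le> i" "1 \<le> j" "j \<le> k" "k \<le> n"
  defines "v \<equiv> \<lambda>a. desusp (x a)" and "f \<equiv> \<lambda>a. e a - 1"
  shows "(\<Sum>\<sigma> \<in> unshuffles (k - j) (j - 1).
          susp_scale scale (chi (k - 1) \<sigma> e * (-1) ^ ((k + 1 - j) * (j - 1))
                  * (-1) powi (int j * (\<Sum>a = 1..k-j. e (\<sigma> a))))
            (derived_bracket scale V br \<delta> i (map (\<lambda>a. x (\<sigma> a)) [1..<k-j+1]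
                  @ [derived_bracket scale V br \<delta> j (map (\<lambda>a. x (\<sigma> a)) [k+1-j..<k] @ [x k])]
                  @ map x [k+1..<i+j]))) =
    Susp (signed (int (n - 1) + (\<Sum>a = 1..n. int (n - a) * f a))
      (foldl br (top_sum v f (\<delta> (i - 1)) (\<delta> (j - 1)) (k - 1) {B. B \<subseteq> {1..k - 1} \<and> card B = j - 1})
        (map v [Suc k..<Suc n])))" (is "?lhs = _")
proof -
  define \<alpha> q r where "\<alpha> = k - j" and "q = j - 1" and "r = n - k"
  have eqs: "k = \<alpha> + q + 1" "n = \<alpha> + r + q + 1" "i = \<alpha> + r + 1" "j = q + 1"
    using ij by (auto simp: \<alpha>_def q_def r_def)
  have diffs: "k - j = \<alpha>" "j - 1 = q" "k - 1 = \<alpha> + q" "k + 1 - j = \<alpha> + 1" "i - 1 = \<alpha> + r"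
    "i + j = n + 1"
    using eqs by simp_all
  have v: "v a \<in> V (f a)" if "a \<in> {1..\<alpha> + r + q + 1}" for a
    using x[of a] that eqs by (auto simp: v_def f_def susp_grading_def)
  let ?G = "int (n - 1) + (\<Sum>a = 1..n. int (n - a) * f a)"
  let ?g = "\<lambda>B. foldl br (nested_product br v f (\<delta> (i - 1)) (\<delta> (j - 1)) ({1..k-1} - B) (insert k B))
    (map v [Suc k..<Suc n])"
  have x_eq: "x = (\<lambda>a. Susp (v a))"
    by (simp add: v_def)
  have "susp_scale scale (chi (k - 1) \<sigma> e * (-1) ^ ((k + 1 - j) * (j - 1))
                  * (-1) powi (int j * (\<Sum>a = 1..k-j. e (\<sigma> a))))
            (derived_bracket scale V br \<delta> i (map (\<lambda>a. x (\<sigma> a)) [1..<k-j+1]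
                  @ [derived_bracket scale V br \<delta> j (map (\<lambda>a. x (\<sigma> a)) [k+1-j..<k] @ [x k])]
                  @ map x [k+1..<i+j])) = Susp (signed ?G (?g (\<sigma> ` {\<alpha>+1..\<alpha>+q})))"
    if "\<sigma> \<in> unshuffles \<alpha> q" for \<sigma>
    using bracket_term[where v = v and f = f and e = e and r = r, OF v _ that]
    unfolding eqs[symmetric] diffs x_eq by (simp only: f_def diff_add_cancel Suc_eq_plus1)
  then have "?lhs =
      (\<Sum>\<sigma> \<in> unshuffles \<alpha> q. Susp (signed ?G (?g (\<sigma> ` {\<alpha>+1..\<alpha>+q}))))"
    unfolding diffs(1,2) by (rule sum.cong[OF refl])
  also have "\<dots> = (\<Sum>B | B \<subseteq> {1..\<alpha>+q} \<and> card B = q. Susp (signed ?G (?g B)))"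
    by (rule sum.reindex_bij_betw[OF bij_betw_unshuffles])
  also have "\<dots> = Susp (signed ?G (\<Sum>B | B \<subseteq> {1..\<alpha>+q} \<and> card B = q. ?g B))"
    by (simp add: sum_susp signed_def sum_negf)
  finally have "?lhs = Susp (signed ?G (\<Sum>B | B \<subseteq> {1..\<alpha>+q} \<and> card B = q. ?g B))" .
  moreover have "Suc (k - 1) = k"
    using eqs(1) by simp
  ultimately show ?thesis
    unfolding top_sum_def foldl_br_sum by (simp only: diffs(2,3))
qed

text \<open>Adding the sum to its reversal pairs (p, q) with (q, p) and produces anticommutators.
  Their total is twice the coefficient of t^(n-1) in the square of the deformation, which is 0; in
  characteristic zero the factor 2 cancels.\<close>

lemma sum_composite_eq_zero:
  assumes n: "1 \<le> n" and v: "\<And>a. a \<in> {1..n} \<Longrightarrow> v a \<in> V (f a)"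
  shows "(\<Sum>q<n. composite_sum v f (\<delta> (n - Suc q)) (\<delta> q) q n) = 0"
proof -
  let ?g = "\<lambda>p q. composite_sum v f (\<delta> p) (\<delta> q) q n" and ?us = "map v [2..<Suc n]"
  let ?c = "\<Sum>q<n. \<delta> q (\<delta> (n - Suc q) (v 1))"
  have rev: "(\<Sum>q<n. h (n - Suc q) q) = (\<Sum>q<n. h q (n - Suc q))" for h :: "nat \<Rightarrow> nat \<Rightarrow> 'v"
    by (rule sum.reindex_bij_witness[of _ "\<lambda>q. n - Suc q" "\<lambda>q. n - Suc q"]) auto
  have "?c = (\<Sum>q\<le>n - 1. \<delta> q (\<delta> (n - 1 - q) (v 1)))"
    using n by (intro sum.cong) auto
  then have c: "?c = 0"
    unfolding square_zero .
  have "(\<Sum>q<n. ?g (n - Suc q) q) + (\<Sum>q<n. ?g (n - Suc q) q) =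
      (\<Sum>q<n. ?g (n - Suc q) q + ?g q (n - Suc q))"
    using rev[of ?g] by (simp add: sum.distrib)
  also have "\<dots> = (\<Sum>q<n. foldl br (\<delta> (n - Suc q) (\<delta> q (v 1)) + \<delta> q (\<delta> (n - Suc q) (v 1))) ?us)"
    by (intro sum.cong refl composite_sum_commutator v derivation_coefficient) auto
  also have "\<dots> = foldl br (?c + ?c) ?us"
    using rev[of "\<lambda>p q. \<delta> p (\<delta> q (v 1))"] by (simp add: foldl_br_sum[symmetric] sum.distrib)
  finally have "scale 2 (\<Sum>q<n. ?g (n - Suc q) q) = 0"
    using scale_left_distrib[of 1 1] by (simp only: c) simp
  then show ?thesis
    by simp
qed

lemma sh_identity:
  assumes n: "1 \<le> n" and x: "\<And>a. a \<in> {1..n} \<Longrightarrow> x a \<in> susp_grading V (e a)"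
  shows "(\<Sum>(i, j) \<in> {(i, j). i + j = n + 1 \<and> 1 \<le> i \<and> 1 \<le> j}.
        \<Sum>k = j..i+j-1. \<Sum>\<sigma> \<in> unshuffles (k - j) (j - 1).
          susp_scale scale (chi (k - 1) \<sigma> e * (-1) ^ ((k + 1 - j) * (j - 1))
                  * (-1) powi (int j * (\<Sum>a = 1..k-j. e (\<sigma> a))))
            (derived_bracket scale V br \<delta> i (map (\<lambda>a. x (\<sigma> a)) [1..<k-j+1]
                  @ [derived_bracket scale V br \<delta> j (map (\<lambda>a. x (\<sigma> a)) [k+1-j..<k] @ [x k])]
                  @ map x [k+1..<i+j]))) = 0" (is "(\<Sum>(i, j)\<in>?I. \<Sum>k = j..i+j-1. ?T i j k) = 0")
proof -
  define v where "v = (\<lambda>a. desusp (x a))"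
  define f where "f = (\<lambda>a. e a - 1)"
  \<comment> \<open>The global sign depends on neither i, j nor k.\<close>
  define G where "G = int (n - 1) + (\<Sum>a = 1..n. int (n - a) * f a)"
  have v: "v a \<in> V (f a)" if "a \<in> {1..n}" for a
    using x[OF that] by (auto simp: v_def f_def susp_grading_def)
  have "(\<Sum>k = j..i+j-1. ?T i j k) = Susp (signed G (composite_sum v f (\<delta> (i - 1)) (\<delta> (j - 1)) (j - 1) n))"
    if "i + j = n + 1" "1 \<le> i" "1 \<le> j" for i j
  proof -
    have "(\<Sum>k = j..i+j-1. ?T i j k) = (\<Sum>k = Suc (j - 1)..n. Susp (signed G
        (foldl br (top_sum v f (\<delta> (i - 1)) (\<delta> (j - 1)) (k - 1) {B. B \<subseteq> {1..k - 1} \<and> card B = j - 1})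
        (map v [Suc k..<Suc n]))))"
      unfolding v_def f_def G_def
      by (intro sum.cong sum_unshuffles_bracket_term[OF x]) (use that in auto)
    then show ?thesis
      by (simp add: composite_sum_eq sum_susp signed_def sum_negf del: upt_Suc)
  qed
  then have "(\<Sum>(i, j)\<in>?I. \<Sum>k = j..i+j-1. ?T i j k) =
      (\<Sum>(i, j)\<in>?I. Susp (signed G (composite_sum v f (\<delta> (i - 1)) (\<delta> (j - 1)) (j - 1) n)))"
    by (intro sum.cong) auto
  also have "\<dots> = (\<Sum>q<n. Susp (signed G (composite_sum v f (\<delta> (n - Suc q)) (\<delta> q) q n)))"
  proof (rule sum.reindex_bij_witness[of _ "\<lambda>q. (n - q, Suc q)" "\<lambda>(i, j). j - 1"])
    fix z assume "z \<in> ?I"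
    then obtain i j where "z = (i, j)" "n - Suc (j - 1) = i - 1"
      by auto
    then show "Susp (signed G (composite_sum v f (\<delta> (n - Suc ((\<lambda>(i, j). j - 1) z))) (\<delta> ((\<lambda>(i, j). j - 1) z)) ((\<lambda>(i, j). j - 1) z) n)) =
        (\<lambda>(i, j). Susp (signed G (composite_sum v f (\<delta> (i - 1)) (\<delta> (j - 1)) (j - 1) n))) z"
      by simp
  qed auto
  also have "\<dots> = Susp (signed G (\<Sum>q<n. composite_sum v f (\<delta> (n - Suc q)) (\<delta> q) q n))"
    by (simp add: sum_susp signed_def sum_negf)
  also have "(\<Sum>q<n. composite_sum v f (\<delta> (n - Suc q)) (\<delta> q) q n) = 0"
    by (rule sum_composite_eq_zero[OF n]) (rule v)
  finally show ?thesis
    by (simp only: signed_def zero_suspension_def minus_zero if_cancel)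
qed

theorem sh_leibniz_algebra_derived_bracket:
  "sh_leibniz_algebra (susp_scale scale) (susp_grading V) (derived_bracket scale V br \<delta>)"
proof (intro sh_leibniz_algebra.intro sh_leibniz_algebra_axioms.intro graded_vector_space_susp)
  show "multilinear (susp_scale scale) i (derived_bracket scale V br \<delta> i)" if "1 \<le> i" for i
    by (rule multilinear_derived_bracket[OF that linear_coefficient])
qed (rule degree_derived_bracket sh_identity; assumption)+

end

text \<open>This is the coefficient of t^m when the squared operator is applied to the constant
  series \<open>u\<close>.\<close>

lemma square_zero_formal_deformation:
  assumes "formal_deformation scale V br \<delta>\<^sub>0 \<delta>"
  shows "(\<Sum>i\<le>m. \<delta> i (\<delta> (m - i) u)) = 0"
proof -
  let ?f = "Abs_fps (\<lambda>n. if n = 0 then u else 0)"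
  have "\<delta> i 0 = 0" for i
    using assms unfolding formal_deformation_def derivation_def linear_iff_module_hom
    by (metis module_hom.zero)
  then have "fps_nth (fps_operator \<delta> ?f) m = \<delta> m u" for m
  proof -
    have "(\<Sum>i\<le>m. \<delta> i (if m - i = 0 then u else 0)) = (\<Sum>i\<in>{m}. \<delta> i u)"
      using \<open>\<And>i. \<delta> i 0 = 0\<close> by (intro sum.mono_neutral_cong_right) auto
    then show ?thesis by (simp add: fps_operator_def)
  qed
  then have "fps_nth (fps_operator \<delta> (fps_operator \<delta> ?f)) m = (\<Sum>i\<le>m. \<delta> i (\<delta> (m - i) u))"
    by (simp add: fps_operator_def[of \<delta> "fps_operator \<delta> ?f"])
  then show ?thesis
    using assms by (simp add: formal_deformation_def)
qed

theorem theorem3p4: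
  fixes scale :: "'k::field_char_0 \<Rightarrow> 'v::ab_group_add \<Rightarrow> 'v"
    and V :: "int \<Rightarrow> 'v set"
    and br :: "'v \<Rightarrow> 'v \<Rightarrow> 'v"
    and \<delta>\<^sub>0 :: "'v \<Rightarrow> 'v"
    and \<delta> :: "nat \<Rightarrow> 'v \<Rightarrow> 'v"
  assumes "dg_leibniz_algebra scale V \<delta>\<^sub>0 br"
    and "formal_deformation scale V br \<delta>\<^sub>0 \<delta>"
  shows "sh_leibniz_algebra (susp_scale scale) (susp_grading V) (derived_bracket scale V br \<delta>)"
proof -
  have "square_zero_deformation scale V \<delta>\<^sub>0 br \<delta>"
    using assms square_zero_formal_deformation[OF assms(2)]
    by (auto simp: square_zero_deformation_def square_zero_deformation_axioms_def formal_deformation_def)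
  then show ?thesis
    by (rule square_zero_deformation.sh_leibniz_algebra_derived_bracket)
qed

end
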